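(* Every finitary monad $\mathbb{T}=(T,\eta,\mu)$ on $\mathsf{Pos}$ is the free-algebra monad of its associated variety $\mathcal{V}_{\mathbb{T}}$.
   Context: $\mathsf{Pos}$ is the category of posets and monotone maps. $\mathsf{Pos}_{\mathsf f}$ is a fixed representative set of all finite posets up to isomorphism; its members are called contexts, and the elements of a context are called variables. For posets $X,Y$, $\mathsf{Pos}_0(X,Y)$ is the set of monotone maps $X\to Y$. $|X|$ denotes the underlying set of a poset $X$. A monad is finitary if its underlying functor preserves filtered colimits. A signature $\Sigma$ is a family of sets $(\Sigma_\Gamma)_{\Gamma\in\mathsf{Pos}_{\mathsf f}}$; elements $\sigma\in\Sigma_\Gamma$ are operation symbols of arity $\Gamma$. A $\Sigma$-algebra is a poset $A$ with a function $\sigma_A\colon\mathsf{Pos}_0(\Gamma,A)\to A$ (not required to be monotone) for every $\Gamma\in\mathsf{Pos}_{\mathsf f}$ and $\sigma\in\Sigma_\Gamma$. A homomorphism $h\colon A\to B$ is a monotone map with $h(\sigma_A(f))=\sigma_B(h\cdot f)$ for all $\sigma\in\Sigma_\Gamma$, $f\in\mathsf{Pos}_0(\Gamma,A)$. These form the category $\mathsf{Alg}\,\Sigma$. For a context $\Gamma$, the set $\mathscr{T}(\Gamma)$ of terms is the least set containing $|\Gamma|$ such that for every $\sigma\in\Sigma_\Delta$ and every function $g\colon|\Delta|\to\mathscr{T}(\Gamma)$ there is a term $\sigma(g)\in\mathscr{T}(\Gamma)$ (terms are formed freely, ignoring the order of arities). An operation symbol $\sigma\in\Sigma_\Gamma$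 is also regarded as the term $\sigma(u_\Gamma)\in\mathscr{T}(\Gamma)$, where $u_\Gamma\colon|\Gamma|\to\mathscr{T}(\Gamma)$ is the inclusion. Given a $\Sigma$-algebra $A$ and a monotone $f\colon\Gamma\to A$, the evaluation is the partial map $f^{\#}\colon\mathscr{T}(\Gamma)\to|A|$ defined recursively: $f^{\#}(x)=f(x)$ for $x\in|\Gamma|$; for $\sigma\in\Sigma_\Delta$ and $g\colon|\Delta|\to\mathscr{T}(\Gamma)$, $f^{\#}(\sigma(g))$ is defined iff all $f^{\#}(g(i))$, $i\in|\Delta|$, are defined and $i\le j$ in $\Delta$ implies $f^{\#}(g(i))\le f^{\#}(g(j))$ in $A$, and then $f^{\#}(\sigma(g))=\sigma_A(f^{\#}\cdot g)$. An inequation in context $\Gamma\vdash s\le t$ is a pair $s,t\in\mathscr{T}(\Gamma)$; $A$ satisfies it if for every monotone $f\colon\Gamma\to A$ both $f^{\#}(s)$ and $f^{\#}(t)$ are defined and $f^{\#}(s)\le f^{\#}(t)$. $\Gamma\vdash s=t$ denotes the conjunction of $\Gamma\vdash s\le t$ and $\Gamma\vdash t\le s$. A variety of $\Sigma$-algebras is the full subcategory of $\mathsf{Alg}\,\Sigma$ of all algebras satisfying a given set of inequations in context. The forgetful functor from a variety $\mathcal{V}$ to $\mathsf{Pos}$ has a left adjoint; the ensuing monad on $\mathsf{Pos}$ (determined up to isomorphism of monads) is the free-algebra monad $\mathbb{T}_{\mathcal{V}}$ of $\mathcal{V}$. Given a finitary monad $\mathbb{T}=(T,\eta,\mu)$ on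 $\mathsf{Pos}$, write $k^{*}=\mu_Y\cdot Tk\colon TX\to TY$ for monotone $k\colon X\to TY$. The associated variety $\mathcal{V}_{\mathbb{T}}$ has the signature $\Sigma_\Gamma=|T\Gamma|$ ($\Gamma\in\mathsf{Pos}_{\mathsf f}$) and is specified by inequations of the following two types, for every context $\Gamma$: (1) $\Gamma\vdash\sigma\le\tau$ for all $\sigma\le\tau$ in $T\Gamma$; (2) $\Gamma\vdash k^{*}(\sigma)=\sigma(k)$ for all $\Delta\in\mathsf{Pos}_{\mathsf f}$, all monotone $k\colon\Delta\to T\Gamma$ and all $\sigma\in T\Delta$. Here elements of $T\Gamma$ are operation symbols of arity $\Gamma$ regarded as terms in $\mathscr{T}(\Gamma)$, and $\sigma(k)$ is the term built from $\sigma\in\Sigma_\Delta$ and the terms $k(i)$, $i\in|\Delta|$.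
   Formalization: The associated variety is given the additional equations Γ ⊢ η_Γ(x) = x for all contexts Γ and variables x; with types (1) and (2) alone the claim fails, e.g. for the identity monad, because posets with all operations constant at one common value satisfy both types. *)

theory Defs
  imports Main "HOL-Library.FuncSet"
begin

unbundle cardinal_syntax

section \<open>Categories, functors, adjunctions, monads\<close>

text \<open>Hom-sets need not be disjoint, so composition and the action of functors on morphisms take
  the relevant objects as arguments: \<open>cmp C X Y Z g f\<close> is the composite of \<open>f : X \<rightarrow> Y\<close> and
  \<open>g : Y \<rightarrow> Z\<close>. The values of all components on non-objects and non-morphisms are irrelevant.\<close>

record ('o, 'm) cat =
  obj :: "'o set"
  hom :: "'o \<Rightarrow> 'o \<Rightarrow> 'm set"
  ide :: "'o \<Rightarrow> 'm"
  cmp :: "'o \<Rightarrow> 'o \<Rightarrow> 'o \<Rightarrow> 'm \<Rightarrow> 'm \<Rightarrow> 'm"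

definition is_category :: "('o, 'm) cat \<Rightarrow> bool" where
  "is_category C \<longleftrightarrow>
     (\<forall>X\<in>obj C. ide C X \<in> hom C X X) \<and>
     (\<forall>X\<in>obj C. \<forall>Y\<in>obj C. \<forall>Z\<in>obj C. \<forall>f\<in>hom C X Y. \<forall>g\<in>hom C Y Z.
        cmp C X Y Z g f \<in> hom C X Z) \<and>
     (\<forall>X\<in>obj C. \<forall>Y\<in>obj C. \<forall>f\<in>hom C X Y.
        cmp C X X Y f (ide C X) = f \<and> cmp C X Y Y (ide C Y) f = f) \<and>
     (\<forall>W\<in>obj C. \<forall>X\<in>obj C. \<forall>Y\<in>obj C. \<forall>Z\<in>obj C.
        \<forall>f\<in>hom C W X. \<forall>g\<in>hom C X Y. \<forall>h\<in>hom C Y Z.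
        cmp C W X Z (cmp C X Y Z h g) f = cmp C W Y Z h (cmp C W X Y g f))"

definition isomorphism :: "('o, 'm) cat \<Rightarrow> 'o \<Rightarrow> 'o \<Rightarrow> 'm \<Rightarrow> bool" where
  "isomorphism C X Y f \<longleftrightarrow> f \<in> hom C X Y \<and>
     (\<exists>g\<in>hom C Y X. cmp C X Y X g f = ide C X \<and> cmp C Y X Y f g = ide C Y)"

record ('o1, 'm1, 'o2, 'm2) ftr =
  fob :: "'o1 \<Rightarrow> 'o2"
  fmor :: "'o1 \<Rightarrow> 'o1 \<Rightarrow> 'm1 \<Rightarrow> 'm2"

definition is_functor ::
  "('o1, 'm1) cat \<Rightarrow> ('o2, 'm2) cat \<Rightarrow> ('o1, 'm1, 'o2, 'm2) ftr \<Rightarrow> bool" where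
  "is_functor C D F \<longleftrightarrow>
     (\<forall>X\<in>obj C. fob F X \<in> obj D) \<and>
     (\<forall>X\<in>obj C. \<forall>Y\<in>obj C. \<forall>f\<in>hom C X Y. fmor F X Y f \<in> hom D (fob F X) (fob F Y)) \<and>
     (\<forall>X\<in>obj C. fmor F X X (ide C X) = ide D (fob F X)) \<and>
     (\<forall>X\<in>obj C. \<forall>Y\<in>obj C. \<forall>Z\<in>obj C. \<forall>f\<in>hom C X Y. \<forall>g\<in>hom C Y Z.
        fmor F X Z (cmp C X Y Z g f) =
        cmp D (fob F X) (fob F Y) (fob F Z) (fmor F Y Z g) (fmor F X Y f))"

definition id_ftr :: "('o, 'm, 'o, 'm) ftr" where
  "id_ftr = \<lparr>fob = (\<lambda>X. X), fmor = (\<lambda>X Y f. f)\<rparr>"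

definition comp_ftr ::
  "('o2, 'm2, 'o3, 'm3) ftr \<Rightarrow> ('o1, 'm1, 'o2, 'm2) ftr \<Rightarrow> ('o1, 'm1, 'o3, 'm3) ftr" where
  "comp_ftr G F = \<lparr>fob = (\<lambda>X. fob G (fob F X)),
                   fmor = (\<lambda>X Y f. fmor G (fob F X) (fob F Y) (fmor F X Y f))\<rparr>"

definition is_nat_trans ::
  "('o1, 'm1) cat \<Rightarrow> ('o2, 'm2) cat \<Rightarrow> ('o1, 'm1, 'o2, 'm2) ftr \<Rightarrow> ('o1, 'm1, 'o2, 'm2) ftr
    \<Rightarrow> ('o1 \<Rightarrow> 'm2) \<Rightarrow> bool" where
  "is_nat_trans C D F G \<alpha> \<longleftrightarrow>
     (\<forall>X\<in>obj C. \<alpha> X \<in> hom D (fob F X) (fob G X)) \<and>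
     (\<forall>X\<in>obj C. \<forall>Y\<in>obj C. \<forall>f\<in>hom C X Y.
        cmp D (fob F X) (fob F Y) (fob G Y) (\<alpha> Y) (fmor F X Y f) =
        cmp D (fob F X) (fob G X) (fob G Y) (fmor G X Y f) (\<alpha> X))"

definition is_monad ::
  "('o, 'm) cat \<Rightarrow> ('o, 'm, 'o, 'm) ftr \<Rightarrow> ('o \<Rightarrow> 'm) \<Rightarrow> ('o \<Rightarrow> 'm) \<Rightarrow> bool" where
  "is_monad C T \<eta> \<mu> \<longleftrightarrow>
     is_functor C C T \<and>
     is_nat_trans C C id_ftr T \<eta> \<and>
     is_nat_trans C C (comp_ftr T T) T \<mu> \<and>
     (\<forall>X\<in>obj C. let TX = fob T X; TTX = fob T TX; TTTX = fob T TTX in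
        cmp C TX TTX TX (\<mu> X) (\<eta> TX) = ide C TX \<and>
        cmp C TX TTX TX (\<mu> X) (fmor T X TX (\<eta> X)) = ide C TX \<and>
        cmp C TTTX TTX TX (\<mu> X) (\<mu> TX) = cmp C TTTX TTX TX (\<mu> X) (fmor T TTX TX (\<mu> X)))"

text \<open>The component at \<open>X\<close> of the horizontal composite \<open>\<theta>\<theta> : SS \<rightarrow> TT\<close> is
  \<open>\<theta>\<^bsub>TX\<^esub> \<cdot> S \<theta>\<^bsub>X\<^esub>\<close>.\<close>

definition isomorphic_monads ::
  "('o, 'm) cat \<Rightarrow> ('o, 'm, 'o, 'm) ftr \<Rightarrow> ('o \<Rightarrow> 'm) \<Rightarrow> ('o \<Rightarrow> 'm)
    \<Rightarrow> ('o, 'm, 'o, 'm) ftr \<Rightarrow> ('o \<Rightarrow> 'm) \<Rightarrow> ('o \<Rightarrow> 'm) \<Rightarrow> bool" where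
  "isomorphic_monads C S \<eta>S \<mu>S T \<eta>T \<mu>T \<longleftrightarrow>
     (\<exists>\<theta>. is_nat_trans C C S T \<theta> \<and>
        (\<forall>X\<in>obj C. let SX = fob S X; TX = fob T X in
           isomorphism C SX TX (\<theta> X) \<and>
           cmp C X SX TX (\<theta> X) (\<eta>S X) = \<eta>T X \<and>
           cmp C (fob S SX) SX TX (\<theta> X) (\<mu>S X) =
           cmp C (fob S SX) (fob T TX) TX (\<mu>T X)
             (cmp C (fob S SX) (fob S TX) (fob T TX) (\<theta> TX) (fmor S SX TX (\<theta> X)))))"

text \<open>\<open>F\<close> is left adjoint to \<open>U\<close>, with unit \<open>\<eta>\<close> and counit \<open>\<epsilon>\<close>.\<close>

definition is_adjunction ::
  "('o1, 'm1) cat \<Rightarrow> ('o2, 'm2) cat \<Rightarrow> ('o1, 'm1, 'o2, 'm2) ftr \<Rightarrow> ('o2, 'm2, 'o1, 'm1) ftr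
    \<Rightarrow> ('o1 \<Rightarrow> 'm1) \<Rightarrow> ('o2 \<Rightarrow> 'm2) \<Rightarrow> bool" where
  "is_adjunction C D F U \<eta> \<epsilon> \<longleftrightarrow>
     is_functor C D F \<and> is_functor D C U \<and>
     is_nat_trans C C id_ftr (comp_ftr U F) \<eta> \<and>
     is_nat_trans D D (comp_ftr F U) id_ftr \<epsilon> \<and>
     (\<forall>X\<in>obj C. let FX = fob F X; UFX = fob U FX in
        cmp D FX (fob F UFX) FX (\<epsilon> FX) (fmor F X UFX (\<eta> X)) = ide D FX) \<and>
     (\<forall>A\<in>obj D. let UA = fob U A; FUA = fob F UA in
        cmp C UA (fob U FUA) UA (fmor U FUA A (\<epsilon> A)) (\<eta> UA) = ide C UA)"

definition adj_mult ::
  "('o1, 'm1, 'o2, 'm2) ftr \<Rightarrow> ('o2, 'm2, 'o1, 'm1) ftr \<Rightarrow> ('o2 \<Rightarrow> 'm2) \<Rightarrow> 'o1 \<Rightarrow> 'm1" where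
  "adj_mult F U \<epsilon> X = fmor U (fob F (fob U (fob F X))) (fob F X) (\<epsilon> (fob F X))"

section \<open>Filtered colimits\<close>

definition is_filtered :: "('i, 'j) cat \<Rightarrow> bool" where
  "is_filtered J \<longleftrightarrow>
     obj J \<noteq> {} \<and>
     (\<forall>i\<in>obj J. \<forall>j\<in>obj J. \<exists>k\<in>obj J. hom J i k \<noteq> {} \<and> hom J j k \<noteq> {}) \<and>
     (\<forall>i\<in>obj J. \<forall>j\<in>obj J. \<forall>f\<in>hom J i j. \<forall>g\<in>hom J i j.
        \<exists>k\<in>obj J. \<exists>h\<in>hom J j k. cmp J i j k h f = cmp J i j k h g)"

definition is_cocone ::
  "('i, 'j) cat \<Rightarrow> ('o, 'm) cat \<Rightarrow> ('i, 'j, 'o, 'm) ftr \<Rightarrow> 'o \<Rightarrow> ('i \<Rightarrow> 'm) \<Rightarrow> bool" where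
  "is_cocone J C D c l \<longleftrightarrow>
     c \<in> obj C \<and>
     (\<forall>i\<in>obj J. l i \<in> hom C (fob D i) c) \<and>
     (\<forall>i\<in>obj J. \<forall>j\<in>obj J. \<forall>u\<in>hom J i j.
        cmp C (fob D i) (fob D j) c (l j) (fmor D i j u) = l i)"

definition is_colimit ::
  "('i, 'j) cat \<Rightarrow> ('o, 'm) cat \<Rightarrow> ('i, 'j, 'o, 'm) ftr \<Rightarrow> 'o \<Rightarrow> ('i \<Rightarrow> 'm) \<Rightarrow> bool" where
  "is_colimit J C D c l \<longleftrightarrow>
     is_cocone J C D c l \<and>
     (\<forall>d m. is_cocone J C D d m \<longrightarrow>
        (\<exists>!h. h \<in> hom C c d \<and> (\<forall>i\<in>obj J. cmp C (fob D i) c d h (l i) = m i)))"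

section \<open>The category of posets\<close>

text \<open>The type \<open>'u\<close> plays the role of a universe: its subsets of strictly smaller cardinality are
  the small sets. For \<open>'u\<close> of inaccessible cardinality these are, up to bijection, the sets of a
  Grothendieck universe. As such types cannot be shown to exist in HOL, only two of the properties
  of an inaccessible cardinal are required below.\<close>

definition small :: "'u set \<Rightarrow> bool" where
  "small A \<longleftrightarrow> |A| <o |UNIV :: 'u set|"

definition universe :: "'u itself \<Rightarrow> bool" where
  "universe (_ :: 'u itself) \<longleftrightarrow>
     natLeq <o |UNIV :: 'u set| \<and> regularCard |UNIV :: 'u set|"

text \<open>A poset is given by its order relation \<open>X\<close>; its underlying set is \<open>Field X\<close>. Monotone maps
  are extensional, i.e. \<^const>\<open>undefined\<close> outside \<open>Field X\<close>, so that equality of morphisms is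
  equality of functions.\<close>

definition mono_maps :: "'u rel \<Rightarrow> 'v rel \<Rightarrow> ('u \<Rightarrow> 'v) set" where
  "mono_maps X Y = {f \<in> Field X \<rightarrow>\<^sub>E Field Y.
     monotone_on (Field X) (\<lambda>x y. (x, y) \<in> X) (\<lambda>x y. (x, y) \<in> Y) f}"

definition Pos :: "('u rel, 'u \<Rightarrow> 'u) cat" where
  "Pos = \<lparr>obj = {X. Partial_order X \<and> small (Field X)},
          hom = mono_maps,
          ide = (\<lambda>X. \<lambda>x\<in>Field X. x),
          cmp = (\<lambda>X Y Z g f. compose (Field X) g f)\<rparr>"

definition is_finitary :: "('u rel, 'u \<Rightarrow> 'u, 'u rel, 'u \<Rightarrow> 'u) ftr \<Rightarrow> bool" where
  "is_finitary T \<longleftrightarrow>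
     (\<forall>(J :: ('u, 'u) cat) D c l.
        is_category J \<and> small (obj J) \<and> (\<forall>i\<in>obj J. \<forall>j\<in>obj J. small (hom J i j)) \<and>
        is_filtered J \<and> is_functor J Pos D \<and> is_colimit J Pos D c l \<longrightarrow>
        is_colimit J Pos (comp_ftr T D) (fob T c) (\<lambda>i. fmor T (fob D i) c (l i)))"

text \<open>Any finite poset, of whatever type, is isomorphic to one whose elements are of the infinite
  type \<open>'u\<close>.\<close>

definition is_context_set :: "'u rel set \<Rightarrow> bool" where
  "is_context_set ctx \<longleftrightarrow>
     (\<forall>\<Gamma>\<in>ctx. Partial_order \<Gamma> \<and> finite (Field \<Gamma>)) \<and>
     (\<forall>X. Partial_order X \<and> finite (Field X) \<longrightarrow> (\<exists>!\<Gamma>. \<Gamma> \<in> ctx \<and> (\<exists>f. isomorphism Pos X \<Gamma> f)))"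

section \<open>Algebras and terms\<close>

type_synonym ('u, 's) signature = "'u rel \<Rightarrow> 's set"

record ('u, 's) algebra =
  poset :: "'u rel"
  oper :: "'u rel \<Rightarrow> 's \<Rightarrow> ('u \<Rightarrow> 'u) \<Rightarrow> 'u"

definition Alg :: "'u rel set \<Rightarrow> ('u, 's) signature \<Rightarrow> (('u, 's) algebra, 'u \<Rightarrow> 'u) cat" where
  "Alg ctx \<Sigma> =
     \<lparr>obj = {A. poset A \<in> obj Pos \<and>
               oper A \<in> (\<Pi>\<^sub>E \<Gamma>\<in>ctx. \<Pi>\<^sub>E \<sigma>\<in>\<Sigma> \<Gamma>. mono_maps \<Gamma> (poset A) \<rightarrow>\<^sub>E Field (poset A))},
      hom = (\<lambda>A B. {h \<in> mono_maps (poset A) (poset B).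
               \<forall>\<Gamma>\<in>ctx. \<forall>\<sigma>\<in>\<Sigma> \<Gamma>. \<forall>f\<in>mono_maps \<Gamma> (poset A).
                 h (oper A \<Gamma> \<sigma> f) = oper B \<Gamma> \<sigma> (compose (Field \<Gamma>) h f)}),
      ide = (\<lambda>A. ide Pos (poset A)),
      cmp = (\<lambda>A B C. cmp Pos (poset A) (poset B) (poset C))\<rparr>"

text \<open>As the sets \<open>\<Sigma> \<Delta>\<close> need not be disjoint, an operation symbol occurs in a term together with
  its arity. In \<open>Op \<Delta> \<sigma> g\<close> only the values of \<open>g\<close> on \<open>Field \<Delta>\<close> are meaningful, and \<open>terms\<close> contains
  exactly one representative, with \<open>g\<close> extensional.\<close>

datatype ('u, 's) tm = Var 'u | Op "'u rel" 's "'u \<Rightarrow> ('u, 's) tm"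

inductive_set terms :: "'u rel set \<Rightarrow> ('u, 's) signature \<Rightarrow> 'u rel \<Rightarrow> ('u, 's) tm set"
  for ctx :: "'u rel set" and \<Sigma> :: "('u, 's) signature" and \<Gamma> :: "'u rel" where
  Var: "x \<in> Field \<Gamma> \<Longrightarrow> Var x \<in> terms ctx \<Sigma> \<Gamma>"
| Op: "\<lbrakk>\<Delta> \<in> ctx; \<sigma> \<in> \<Sigma> \<Delta>; \<And>i. i \<in> Field \<Delta> \<Longrightarrow> g i \<in> terms ctx \<Sigma> \<Gamma>; g \<in> extensional (Field \<Delta>)\<rbrakk>
       \<Longrightarrow> Op \<Delta> \<sigma> g \<in> terms ctx \<Sigma> \<Gamma>"

definition op_term :: "'u rel \<Rightarrow> 's \<Rightarrow> ('u, 's) tm" where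
  "op_term \<Gamma> \<sigma> = Op \<Gamma> \<sigma> (\<lambda>x\<in>Field \<Gamma>. Var x)"

text \<open>\<open>eval A f\<close> is the partial evaluation map \<open>f\<^sup>#\<close>, with \<open>None\<close> for undefined.\<close>

primrec eval :: "('u, 's) algebra \<Rightarrow> ('u \<Rightarrow> 'u) \<Rightarrow> ('u, 's) tm \<Rightarrow> 'u option" where
  "eval A f (Var x) = Some (f x)"
| "eval A f (Op \<Delta> \<sigma> g) =
     (if (\<forall>i\<in>Field \<Delta>. eval A f (g i) \<noteq> None) \<and>
         (\<forall>(i, j)\<in>\<Delta>. (the (eval A f (g i)), the (eval A f (g j))) \<in> poset A)
      then Some (oper A \<Delta> \<sigma> (\<lambda>i\<in>Field \<Delta>. the (eval A f (g i))))
      else None)"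

type_synonym ('u, 's) inequation = "'u rel \<times> ('u, 's) tm \<times> ('u, 's) tm"

definition inequations :: "'u rel set \<Rightarrow> ('u, 's) signature \<Rightarrow> ('u, 's) inequation set" where
  "inequations ctx \<Sigma> = {(\<Gamma>, s, t). \<Gamma> \<in> ctx \<and> s \<in> terms ctx \<Sigma> \<Gamma> \<and> t \<in> terms ctx \<Sigma> \<Gamma>}"

definition satisfies :: "('u, 's) algebra \<Rightarrow> ('u, 's) inequation \<Rightarrow> bool" where
  "satisfies A = (\<lambda>(\<Gamma>, s, t). \<forall>f\<in>mono_maps \<Gamma> (poset A).
     \<exists>a b. eval A f s = Some a \<and> eval A f t = Some b \<and> (a, b) \<in> poset A)"

section \<open>Varieties and their free-algebra monads\<close>

definition variety ::
  "'u rel set \<Rightarrow> ('u, 's) signature \<Rightarrow> ('u, 's) inequation set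
    \<Rightarrow> (('u, 's) algebra, 'u \<Rightarrow> 'u) cat" where
  "variety ctx \<Sigma> E = Alg ctx \<Sigma> \<lparr>obj := {A \<in> obj (Alg ctx \<Sigma>). \<forall>e\<in>E. satisfies A e}\<rparr>"

definition forget :: "(('u, 's) algebra, 'u \<Rightarrow> 'u, 'u rel, 'u \<Rightarrow> 'u) ftr" where
  "forget = \<lparr>fob = poset, fmor = (\<lambda>A B h. h)\<rparr>"

text \<open>\<open>E\<close> consists of inequations in context over \<open>\<Sigma>\<close>, the forgetful functor has a left adjoint,
  and the monad induced by any left adjoint is isomorphic to \<open>(T, \<eta>, \<mu>)\<close>.\<close>

definition is_free_algebra_monad ::
  "'u rel set \<Rightarrow> ('u, 's) signature \<Rightarrow> ('u, 's) inequation set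
    \<Rightarrow> ('u rel, 'u \<Rightarrow> 'u, 'u rel, 'u \<Rightarrow> 'u) ftr \<Rightarrow> ('u rel \<Rightarrow> 'u \<Rightarrow> 'u) \<Rightarrow> ('u rel \<Rightarrow> 'u \<Rightarrow> 'u)
    \<Rightarrow> bool" where
  "is_free_algebra_monad ctx \<Sigma> E T \<eta> \<mu> \<longleftrightarrow>
     E \<subseteq> inequations ctx \<Sigma> \<and>
     (\<exists>F \<eta>' \<epsilon>. is_adjunction Pos (variety ctx \<Sigma> E) F forget \<eta>' \<epsilon>) \<and>
     (\<forall>F \<eta>' \<epsilon>. is_adjunction Pos (variety ctx \<Sigma> E) F forget \<eta>' \<epsilon> \<longrightarrow>
        isomorphic_monads Pos (comp_ftr forget F) \<eta>' (adj_mult F forget \<epsilon>) T \<eta> \<mu>)"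

section \<open>The variety associated to a monad\<close>

definition kleisli_ext ::
  "('u rel, 'u \<Rightarrow> 'u, 'u rel, 'u \<Rightarrow> 'u) ftr \<Rightarrow> ('u rel \<Rightarrow> 'u \<Rightarrow> 'u)
    \<Rightarrow> 'u rel \<Rightarrow> 'u rel \<Rightarrow> ('u \<Rightarrow> 'u) \<Rightarrow> 'u \<Rightarrow> 'u" where
  "kleisli_ext T \<mu> X Y k =
     cmp Pos (fob T X) (fob T (fob T Y)) (fob T Y) (\<mu> Y) (fmor T X (fob T Y) k)"

definition assoc_sig ::
  "('u rel, 'u \<Rightarrow> 'u, 'u rel, 'u \<Rightarrow> 'u) ftr \<Rightarrow> ('u, 'u) signature" where
  "assoc_sig T \<Gamma> = Field (fob T \<Gamma>)"

definition order_ineqs ::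
  "'u rel set \<Rightarrow> ('u rel, 'u \<Rightarrow> 'u, 'u rel, 'u \<Rightarrow> 'u) ftr \<Rightarrow> ('u, 'u) inequation set" where
  "order_ineqs ctx T =
     {(\<Gamma>, op_term \<Gamma> \<sigma>, op_term \<Gamma> \<tau>) | \<Gamma> \<sigma> \<tau>. \<Gamma> \<in> ctx \<and> (\<sigma>, \<tau>) \<in> fob T \<Gamma>}"

definition equation :: "'u rel \<Rightarrow> ('u, 's) tm \<Rightarrow> ('u, 's) tm \<Rightarrow> ('u, 's) inequation set" where
  "equation \<Gamma> s t = {(\<Gamma>, s, t), (\<Gamma>, t, s)}"

definition subst_eqs ::
  "'u rel set \<Rightarrow> ('u rel, 'u \<Rightarrow> 'u, 'u rel, 'u \<Rightarrow> 'u) ftr \<Rightarrow> ('u rel \<Rightarrow> 'u \<Rightarrow> 'u)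
    \<Rightarrow> ('u, 'u) inequation set" where
  "subst_eqs ctx T \<mu> =
     (\<Union>\<Gamma>\<in>ctx. \<Union>\<Delta>\<in>ctx. \<Union>k\<in>mono_maps \<Delta> (fob T \<Gamma>). \<Union>\<sigma>\<in>Field (fob T \<Delta>).
        equation \<Gamma> (op_term \<Gamma> (kleisli_ext T \<mu> \<Delta> \<Gamma> k \<sigma>))
                   (Op \<Delta> \<sigma> (\<lambda>i\<in>Field \<Delta>. op_term \<Gamma> (k i))))"

text \<open>The equations \<open>\<Gamma> \<turnstile> \<eta>\<^bsub>\<Gamma>\<^esub>(x) = x\<close> identify the variables with their images in \<open>T\<Gamma>\<close>. They do not
  follow from \<open>order_ineqs\<close> and \<open>subst_eqs\<close>: every poset all of whose operations are constant with
  one and the same value satisfies both of these, so that without the unit equations already the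
  identity monad would not be the free-algebra monad of its associated variety.\<close>

definition unit_eqs :: "'u rel set \<Rightarrow> ('u rel \<Rightarrow> 'u \<Rightarrow> 'u) \<Rightarrow> ('u, 'u) inequation set" where
  "unit_eqs ctx \<eta> =
     (\<Union>\<Gamma>\<in>ctx. \<Union>x\<in>Field \<Gamma>. equation \<Gamma> (op_term \<Gamma> (\<eta> \<Gamma> x)) (Var x))"

definition assoc_ineqs ::
  "'u rel set \<Rightarrow> ('u rel, 'u \<Rightarrow> 'u, 'u rel, 'u \<Rightarrow> 'u) ftr \<Rightarrow> ('u rel \<Rightarrow> 'u \<Rightarrow> 'u)
    \<Rightarrow> ('u rel \<Rightarrow> 'u \<Rightarrow> 'u) \<Rightarrow> ('u, 'u) inequation set" where
  "assoc_ineqs ctx T \<eta> \<mu> = order_ineqs ctx T \<union> subst_eqs ctx T \<mu> \<union> unit_eqs ctx \<eta>"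

end

theory Submission
  imports Defs
begin

text \<open>Let \<open>k\<^sup>*\<close> denote Kleisli extension and \<open>\<V>\<close> the associated variety. The theorem says that \<open>TX\<close>,
  with the operations \<open>\<sigma>(f) = f\<^sup>*(\<sigma>)\<close>, is the free algebra of \<open>\<V>\<close> on \<open>X\<close>, with unit \<open>\<eta>\<close>. It lies in \<open>\<V>\<close>
  because \<open>f\<^sup>*\<close> is monotone, \<open>f\<^sup>* \<cdot> k\<^sup>* = (f\<^sup>* \<cdot> k)\<^sup>*\<close> and \<open>f\<^sup>* \<cdot> \<eta> = f\<close> (\<open>free_obj\<close>).

  The universal property rests on two facts. The first is that operations of a context carry over to
  every finite poset \<open>P\<close>: in an algebra \<open>A\<close> of \<open>\<V>\<close> each \<open>s \<in> TP\<close> acts on monotone maps \<open>P \<rightarrow> A\<close>,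
  by transport along an isomorphism between \<open>P\<close> and a context, and the order, unit and
  substitution laws persist (\<open>xop_order\<close>, \<open>xop_unit\<close>, \<open>xop_subst\<close>). In particular the action is
  natural in \<open>P\<close> (\<open>xop_nat\<close>). The second is that a poset \<open>X\<close> is the directed colimit of its finite
  subposets \<open>P\<close>, which \<open>T\<close> preserves. So a monotone map out of \<open>TX\<close> is a compatible family of
  monotone maps out of the \<open>TP\<close> (\<open>T_universal\<close>), every element of \<open>TX\<close> comes from some \<open>TP\<close>
  (\<open>emb_jointly_surj\<close>), and so does every monotone map from a finite poset to \<open>TX\<close>
  (\<open>finite_map_factors\<close>).

  Given \<open>h : X \<rightarrow> A\<close>, letting \<open>s \<in> TP\<close> act on the restriction of \<open>h\<close> to \<open>P\<close> defines such a compatible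
  family, hence a monotone map \<open>TX \<rightarrow> A\<close> that extends \<open>h\<close>. To see that it preserves an
  operation, move all arguments of the operation to one \<open>TP\<close> and use the substitution law there
  (\<open>hom_free_exists\<close>). This homomorphism is unique since the elements of \<open>TX\<close> are values of operations at generators
  (\<open>hom_free_eqI\<close>). The resulting adjunction induces the monad \<open>T\<close> itself, as \<open>\<mu>\<^bsub>X\<^esub>\<close> is the
  homomorphism that extends the identity of \<open>TX\<close> (\<open>lift_free\<close>), and any other left adjoint
  induces an isomorphic monad (\<open>left_adjoints_isomorphic_monads\<close>).\<close>

section \<open>Uniqueness of left adjoints\<close>

lemma category_rules:
  assumes "is_category C"
  shows cat_ide: "X \<in> obj C \<Longrightarrow> ide C X \<in> hom C X X"
    and cat_cmp: "X \<in> obj C \<Longrightarrow> Y \<in> obj C \<Longrightarrow> Z \<in> obj C \<Longrightarrow> f \<in> hom C X Y \<Longrightarrow>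
      g \<in> hom C Y Z \<Longrightarrow> cmp C X Y Z g f \<in> hom C X Z"
    and cat_ide_right: "X \<in> obj C \<Longrightarrow> Y \<in> obj C \<Longrightarrow> f \<in> hom C X Y \<Longrightarrow>
      cmp C X X Y f (ide C X) = f"
    and cat_ide_left: "X \<in> obj C \<Longrightarrow> Y \<in> obj C \<Longrightarrow> f \<in> hom C X Y \<Longrightarrow>
      cmp C X Y Y (ide C Y) f = f"
    and cat_assoc: "W \<in> obj C \<Longrightarrow> X \<in> obj C \<Longrightarrow> Y \<in> obj C \<Longrightarrow> Z \<in> obj C \<Longrightarrow>
      f \<in> hom C W X \<Longrightarrow> g \<in> hom C X Y \<Longrightarrow> h \<in> hom C Y Z \<Longrightarrow>
      cmp C W X Z (cmp C X Y Z h g) f = cmp C W Y Z h (cmp C W X Y g f)"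
  using assms unfolding is_category_def by blast+

locale adjunction =
  fixes C :: "('o1, 'm1) cat" and D :: "('o2, 'm2) cat"
    and F :: "('o1, 'm1, 'o2, 'm2) ftr" and U :: "('o2, 'm2, 'o1, 'm1) ftr"
    and \<eta> :: "'o1 \<Rightarrow> 'm1" and \<epsilon> :: "'o2 \<Rightarrow> 'm2"
  assumes C: "is_category C" and D: "is_category D"
    and adj: "is_adjunction C D F U \<eta> \<epsilon>"
begin

lemma functors: "is_functor C D F" "is_functor D C U"
  using adj by (simp_all add: is_adjunction_def)

lemma F_obj: "X \<in> obj C \<Longrightarrow> fob F X \<in> obj D"
  and F_map: "X \<in> obj C \<Longrightarrow> Y \<in> obj C \<Longrightarrow> f \<in> hom C X Y \<Longrightarrow>
    fmor F X Y f \<in> hom D (fob F X) (fob F Y)"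
  using functors(1) unfolding is_functor_def by blast+

lemma F_cmp:
  "X \<in> obj C \<Longrightarrow> Y \<in> obj C \<Longrightarrow> Z \<in> obj C \<Longrightarrow> f \<in> hom C X Y \<Longrightarrow> g \<in> hom C Y Z \<Longrightarrow>
    fmor F X Z (cmp C X Y Z g f) = cmp D (fob F X) (fob F Y) (fob F Z) (fmor F Y Z g) (fmor F X Y f)"
  using functors(1) unfolding is_functor_def by blast

lemma U_obj: "A \<in> obj D \<Longrightarrow> fob U A \<in> obj C"
  and U_map: "A \<in> obj D \<Longrightarrow> B \<in> obj D \<Longrightarrow> g \<in> hom D A B \<Longrightarrow>
    fmor U A B g \<in> hom C (fob U A) (fob U B)"
  and U_ide: "A \<in> obj D \<Longrightarrow> fmor U A A (ide D A) = ide C (fob U A)"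
  using functors(2) unfolding is_functor_def by blast+

lemma U_cmp:
  "A \<in> obj D \<Longrightarrow> B \<in> obj D \<Longrightarrow> K \<in> obj D \<Longrightarrow> g \<in> hom D A B \<Longrightarrow> h \<in> hom D B K \<Longrightarrow>
    fmor U A K (cmp D A B K h g) = cmp C (fob U A) (fob U B) (fob U K) (fmor U B K h) (fmor U A B g)"
  using functors(2) unfolding is_functor_def by blast

lemma unit_map: "X \<in> obj C \<Longrightarrow> \<eta> X \<in> hom C X (fob U (fob F X))"
  using adj by (simp add: is_adjunction_def is_nat_trans_def id_ftr_def comp_ftr_def)

lemma unit_nat:
  "X \<in> obj C \<Longrightarrow> Y \<in> obj C \<Longrightarrow> f \<in> hom C X Y \<Longrightarrow>
    cmp C X (fob U (fob F X)) (fob U (fob F Y)) (fmor U (fob F X) (fob F Y) (fmor F X Y f)) (\<eta> X) =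
    cmp C X Y (fob U (fob F Y)) (\<eta> Y) f"
  using adj by (simp add: is_adjunction_def is_nat_trans_def id_ftr_def comp_ftr_def)

lemma counit_map: "A \<in> obj D \<Longrightarrow> \<epsilon> A \<in> hom D (fob F (fob U A)) A"
  using adj by (simp add: is_adjunction_def is_nat_trans_def id_ftr_def comp_ftr_def)

lemma counit_nat:
  "A \<in> obj D \<Longrightarrow> B \<in> obj D \<Longrightarrow> g \<in> hom D A B \<Longrightarrow>
    cmp D (fob F (fob U A)) (fob F (fob U B)) B (\<epsilon> B) (fmor F (fob U A) (fob U B) (fmor U A B g)) =
    cmp D (fob F (fob U A)) A B g (\<epsilon> A)"
  using adj by (simp add: is_adjunction_def is_nat_trans_def id_ftr_def comp_ftr_def)

lemma triangle_F: "X \<in> obj C \<Longrightarrow>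
    cmp D (fob F X) (fob F (fob U (fob F X))) (fob F X) (\<epsilon> (fob F X))
      (fmor F X (fob U (fob F X)) (\<eta> X)) = ide D (fob F X)"
  using adj by (simp add: is_adjunction_def Let_def)

lemma triangle_U: "A \<in> obj D \<Longrightarrow>
    cmp C (fob U A) (fob U (fob F (fob U A))) (fob U A)
      (fmor U (fob F (fob U A)) A (\<epsilon> A)) (\<eta> (fob U A)) = ide C (fob U A)"
  using adj by (simp add: is_adjunction_def Let_def)

text \<open>Composites with the unit are evaluated from the inside out; this is the rewrite rule for it.\<close>

lemma U_cmp_left:
  assumes "X \<in> obj C" "A \<in> obj D" "B \<in> obj D" "K \<in> obj D"
    and "e \<in> hom C X (fob U A)" "g \<in> hom D A B" "h \<in> hom D B K"
  shows "cmp C X (fob U A) (fob U K) (fmor U A K (cmp D A B K h g)) e =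
    cmp C X (fob U B) (fob U K) (fmor U B K h) (cmp C X (fob U A) (fob U B) (fmor U A B g) e)"
  using assms by (simp add: U_cmp cat_assoc[OF C] U_obj U_map)

text \<open>Both morphisms are recovered from their composites with the unit: by a triangle identity and
  naturality of the counit, \<open>g = \<epsilon>\<^bsub>A\<^esub> \<cdot> F(Ug \<cdot> \<eta>\<^bsub>X\<^esub>)\<close>.\<close>

lemma unit_universal:
  assumes X: "X \<in> obj C" and A: "A \<in> obj D"
    and g: "g \<in> hom D (fob F X) A" and h: "h \<in> hom D (fob F X) A"
    and eq: "cmp C X (fob U (fob F X)) (fob U A) (fmor U (fob F X) A g) (\<eta> X) =
      cmp C X (fob U (fob F X)) (fob U A) (fmor U (fob F X) A h) (\<eta> X)"
  shows "g = h"
proof -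
  let ?FX = "fob F X" and ?UFX = "fob U (fob F X)" and ?UA = "fob U A"
  note obj = X A F_obj[OF X] U_obj[OF A] U_obj[OF F_obj[OF X]] F_obj[OF U_obj[OF A]]
    F_obj[OF U_obj[OF F_obj[OF X]]]
  have expand: "k = cmp D ?FX (fob F ?UA) A (\<epsilon> A)
      (fmor F X ?UA (cmp C X ?UFX ?UA (fmor U ?FX A k) (\<eta> X)))"
    if k: "k \<in> hom D ?FX A" for k
  proof -
    note map = k counit_map F_map U_map unit_map
    have "k = cmp D ?FX ?FX A k (cmp D ?FX (fob F ?UFX) ?FX (\<epsilon> ?FX) (fmor F X ?UFX (\<eta> X)))"
      using obj k by (simp add: triangle_F cat_ide_right[OF D])
    also have "\<dots> = cmp D ?FX (fob F ?UFX) A (cmp D (fob F ?UFX) ?FX A k (\<epsilon> ?FX))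
        (fmor F X ?UFX (\<eta> X))"
      using obj map by (simp add: cat_assoc[OF D])
    also have "cmp D (fob F ?UFX) ?FX A k (\<epsilon> ?FX) =
        cmp D (fob F ?UFX) (fob F ?UA) A (\<epsilon> A) (fmor F ?UFX ?UA (fmor U ?FX A k))"
      using obj k by (simp add: counit_nat)
    also have "cmp D ?FX (fob F ?UFX) A \<dots> (fmor F X ?UFX (\<eta> X)) =
        cmp D ?FX (fob F ?UA) A (\<epsilon> A) (cmp D ?FX (fob F ?UFX) (fob F ?UA)
          (fmor F ?UFX ?UA (fmor U ?FX A k)) (fmor F X ?UFX (\<eta> X)))"
      using obj map by (simp add: cat_assoc[OF D])
    finally show ?thesis using obj map by (simp add: F_cmp)
  qed
  show ?thesis using expand[OF g] expand[OF h] eq by simp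
qed

lemma unit_lift:
  assumes X: "X \<in> obj C" and A: "A \<in> obj D" and f: "f \<in> hom C X (fob U A)"
  shows "\<exists>g\<in>hom D (fob F X) A.
    cmp C X (fob U (fob F X)) (fob U A) (fmor U (fob F X) A g) (\<eta> X) = f"
proof -
  let ?FX = "fob F X" and ?UA = "fob U A"
  note obj = X A F_obj[OF X] U_obj[OF A] U_obj[OF F_obj[OF X]] F_obj[OF U_obj[OF A]]
    U_obj[OF F_obj[OF U_obj[OF A]]]
  note map = f counit_map F_map U_map unit_map
  let ?g = "cmp D ?FX (fob F ?UA) A (\<epsilon> A) (fmor F X ?UA f)"
  have "cmp C X (fob U ?FX) ?UA (fmor U ?FX A ?g) (\<eta> X) =
      cmp C X (fob U (fob F ?UA)) ?UA (fmor U (fob F ?UA) A (\<epsilon> A))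
        (cmp C X ?UA (fob U (fob F ?UA)) (\<eta> ?UA) f)"
    using obj map by (simp add: U_cmp_left unit_nat)
  also have "\<dots> = f"
    using obj map by (simp add: cat_assoc[OF C, symmetric] triangle_U cat_ide_left[OF C])
  finally show ?thesis
    using obj map by (intro bexI[of _ ?g]) (auto simp: cat_cmp[OF D])
qed

end

text \<open>The comparison \<open>\<theta>\<^bsub>X\<^esub> : GX \<rightarrow> FX\<close> is the morphism that takes one unit to the other. Every equation
  between morphisms out of some \<open>GX\<close> may be checked after composition with the unit of \<open>G\<close>, where
  it reduces to naturality of the units and a triangle identity.\<close>

theorem left_adjoints_isomorphic_monads:
  assumes C: "is_category C" and D: "is_category D"
    and S: "is_adjunction C D G U \<eta>' \<epsilon>'" and T: "is_adjunction C D F U \<eta> \<epsilon>"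
  shows "isomorphic_monads C (comp_ftr U G) \<eta>' (adj_mult G U \<epsilon>') (comp_ftr U F) \<eta> (adj_mult F U \<epsilon>)"
proof -
  interpret G: adjunction C D G U \<eta>' \<epsilon>' by unfold_locales (fact C D S)+
  interpret F: adjunction C D F U \<eta> \<epsilon> by unfold_locales (fact C D T)+
  note U_obj = F.U_obj and U_map = F.U_map
  define \<theta> where "\<theta> X = (SOME g. g \<in> hom D (fob G X) (fob F X) \<and>
    cmp C X (fob U (fob G X)) (fob U (fob F X)) (fmor U (fob G X) (fob F X) g) (\<eta>' X) = \<eta> X)" for X
  define \<theta>U where "\<theta>U X = fmor U (fob G X) (fob F X) (\<theta> X)" for X
  have \<theta>: "\<theta> X \<in> hom D (fob G X) (fob F X) \<and>
      cmp C X (fob U (fob G X)) (fob U (fob F X)) (\<theta>U X) (\<eta>' X) = \<eta> X" if "X \<in> obj C" for X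
    unfolding \<theta>_def \<theta>U_def
    by (rule someI_ex) (use G.unit_lift[OF that F.F_obj[OF that] F.unit_map[OF that]] in blast)
  have \<theta>_hom: "\<theta> X \<in> hom D (fob G X) (fob F X)" if "X \<in> obj C" for X using \<theta>[OF that] ..
  have \<theta>_unit: "cmp C X (fob U (fob G X)) (fob U (fob F X)) (\<theta>U X) (\<eta>' X) = \<eta> X"
    if "X \<in> obj C" for X using \<theta>[OF that] ..
  have \<theta>U_hom: "\<theta>U X \<in> hom C (fob U (fob G X)) (fob U (fob F X))" if "X \<in> obj C" for X
    unfolding \<theta>U_def using U_map G.F_obj F.F_obj \<theta>_hom that by blast

  have nat: "cmp D (fob G X) (fob G Y) (fob F Y) (\<theta> Y) (fmor G X Y f) =
      cmp D (fob G X) (fob F X) (fob F Y) (fmor F X Y f) (\<theta> X)" (is "?l = ?r")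
    if X: "X \<in> obj C" and Y: "Y \<in> obj C" and f: "f \<in> hom C X Y" for X Y f
  proof (rule G.unit_universal[OF X F.F_obj[OF Y]])
    note obj = X Y G.F_obj[OF X] G.F_obj[OF Y] F.F_obj[OF X] F.F_obj[OF Y]
    note map = f G.F_map[OF X Y f] F.F_map[OF X Y f] \<theta>_hom[OF X] \<theta>_hom[OF Y]
      G.unit_map[OF X] G.unit_map[OF Y] U_map[OF _ _ \<theta>_hom[OF Y]] U_obj
    show "?l \<in> hom D (fob G X) (fob F Y)" "?r \<in> hom D (fob G X) (fob F Y)"
      using obj map cat_cmp[OF D] by blast+
    have "cmp C X (fob U (fob G X)) (fob U (fob F Y)) (fmor U (fob G X) (fob F Y) ?l) (\<eta>' X) =
        cmp C X (fob U (fob G Y)) (fob U (fob F Y)) (\<theta>U Y) (cmp C X Y (fob U (fob G Y)) (\<eta>' Y) f)"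
      using obj map by (simp add: G.U_cmp_left G.unit_nat \<theta>U_def)
    also have "\<dots> = cmp C X Y (fob U (fob F Y)) (\<eta> Y) f"
      using obj map \<theta>U_hom[OF Y] by (simp add: cat_assoc[OF C, symmetric] \<theta>_unit)
    also have "\<dots> = cmp C X (fob U (fob F X)) (fob U (fob F Y))
        (fmor U (fob F X) (fob F Y) (fmor F X Y f)) (\<eta> X)"
      using obj f by (simp add: F.unit_nat)
    also have "\<dots> = cmp C X (fob U (fob G X)) (fob U (fob F Y)) (fmor U (fob G X) (fob F Y) ?r) (\<eta>' X)"
      using obj map \<theta>_unit[OF X] by (simp add: G.U_cmp_left \<theta>U_def)
    finally show "cmp C X (fob U (fob G X)) (fob U (fob F Y)) (fmor U (fob G X) (fob F Y) ?l) (\<eta>' X) =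
      cmp C X (fob U (fob G X)) (fob U (fob F Y)) (fmor U (fob G X) (fob F Y) ?r) (\<eta>' X)" .
  qed

  have iso: "isomorphism C (fob U (fob G X)) (fob U (fob F X)) (\<theta>U X)" if X: "X \<in> obj C" for X
  proof -
    let ?G = "fob G X" and ?F = "fob F X"
    note obj = X G.F_obj[OF X] F.F_obj[OF X] U_obj[OF G.F_obj[OF X]] U_obj[OF F.F_obj[OF X]]
    obtain \<kappa> where \<kappa>: "\<kappa> \<in> hom D ?F ?G"
      and \<kappa>_unit: "cmp C X (fob U ?F) (fob U ?G) (fmor U ?F ?G \<kappa>) (\<eta> X) = \<eta>' X"
      using F.unit_lift[OF X G.F_obj[OF X] G.unit_map[OF X]] by blast
    note map = \<kappa> \<theta>_hom[OF X] G.unit_map[OF X] F.unit_map[OF X]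
    have "cmp D ?G ?F ?G \<kappa> (\<theta> X) = ide D ?G"
    proof (rule G.unit_universal[OF X obj(2)])
      show "cmp D ?G ?F ?G \<kappa> (\<theta> X) \<in> hom D ?G ?G" using obj map cat_cmp[OF D] by blast
      show "ide D ?G \<in> hom D ?G ?G" using obj cat_ide[OF D] by blast
      show "cmp C X (fob U ?G) (fob U ?G) (fmor U ?G ?G (cmp D ?G ?F ?G \<kappa> (\<theta> X))) (\<eta>' X) =
          cmp C X (fob U ?G) (fob U ?G) (fmor U ?G ?G (ide D ?G)) (\<eta>' X)"
        using obj map \<theta>_unit[OF X] \<kappa>_unit
        by (simp add: G.U_cmp_left \<theta>U_def G.U_ide cat_ide_left[OF C])
    qed
    moreover have "cmp D ?F ?G ?F (\<theta> X) \<kappa> = ide D ?F"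
    proof (rule F.unit_universal[OF X obj(3)])
      show "cmp D ?F ?G ?F (\<theta> X) \<kappa> \<in> hom D ?F ?F" using obj map cat_cmp[OF D] by blast
      show "ide D ?F \<in> hom D ?F ?F" using obj cat_ide[OF D] by blast
      show "cmp C X (fob U ?F) (fob U ?F) (fmor U ?F ?F (cmp D ?F ?G ?F (\<theta> X) \<kappa>)) (\<eta> X) =
          cmp C X (fob U ?F) (fob U ?F) (fmor U ?F ?F (ide D ?F)) (\<eta> X)"
        using obj map \<theta>_unit[OF X] \<kappa>_unit
        by (simp add: G.U_cmp_left \<theta>U_def G.U_ide cat_ide_left[OF C])
    qed
    ultimately have
      "cmp C (fob U ?G) (fob U ?F) (fob U ?G) (fmor U ?F ?G \<kappa>) (\<theta>U X) = ide C (fob U ?G)"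
      "cmp C (fob U ?F) (fob U ?G) (fob U ?F) (\<theta>U X) (fmor U ?F ?G \<kappa>) = ide C (fob U ?F)"
      using obj map by (simp_all add: \<theta>U_def G.U_cmp[symmetric] G.U_ide)
    then show ?thesis
      unfolding isomorphism_def using \<theta>U_hom[OF X] U_map[OF obj(3,2) \<kappa>] by blast
  qed

  \<comment> \<open>After composition with the unit both sides become \<open>U\<theta>\<^bsub>X\<^esub>\<close>.\<close>
  have mult: "cmp D (fob G (fob U (fob G X))) (fob G X) (fob F X) (\<theta> X) (\<epsilon>' (fob G X)) =
      cmp D (fob G (fob U (fob G X))) (fob F (fob U (fob F X))) (fob F X) (\<epsilon> (fob F X))
        (cmp D (fob G (fob U (fob G X))) (fob G (fob U (fob F X))) (fob F (fob U (fob F X)))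
          (\<theta> (fob U (fob F X))) (fmor G (fob U (fob G X)) (fob U (fob F X)) (\<theta>U X)))"
    (is "?l = ?r") if X: "X \<in> obj C" for X
  proof -
    let ?G = "fob G X" and ?F = "fob F X"
    let ?UG = "fob U ?G" and ?UF = "fob U ?F"
    note obj = X G.F_obj[OF X] F.F_obj[OF X] U_obj[OF G.F_obj[OF X]] U_obj[OF F.F_obj[OF X]]
    note obj' = obj G.F_obj[OF obj(4)] G.F_obj[OF obj(5)] F.F_obj[OF obj(5)]
    note obj'' = obj' U_obj[OF obj'(6)] U_obj[OF obj'(7)] U_obj[OF obj'(8)]
    note map = \<theta>_hom[OF X] \<theta>_hom[OF obj(5)] \<theta>U_hom[OF X] \<theta>U_hom[OF obj(5)]
      G.counit_map[OF obj(2)] F.counit_map[OF obj(3)]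
      G.unit_map[OF obj(4)] G.unit_map[OF obj(5)] G.F_map[OF obj(4,5) \<theta>U_hom[OF X]]
      U_map[OF _ _ G.counit_map[OF obj(2)]] U_map[OF _ _ F.counit_map[OF obj(3)]]
    show ?thesis
    proof (rule G.unit_universal[OF obj(4,3)])
      show l: "?l \<in> hom D (fob G ?UG) ?F" using obj'' map cat_cmp[OF D] by blast
      have in_r: "cmp D (fob G ?UG) (fob G ?UF) (fob F ?UF) (\<theta> ?UF) (fmor G ?UG ?UF (\<theta>U X))
          \<in> hom D (fob G ?UG) (fob F ?UF)"
        using obj'' map by (intro cat_cmp[OF D])
      then show "?r \<in> hom D (fob G ?UG) ?F" using obj'' map by (intro cat_cmp[OF D])
      have "cmp C ?UG (fob U (fob G ?UG)) ?UF (fmor U (fob G ?UG) ?F ?l) (\<eta>' ?UG) =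
          cmp C ?UG ?UG ?UF (\<theta>U X) (cmp C ?UG (fob U (fob G ?UG)) ?UG
            (fmor U (fob G ?UG) ?G (\<epsilon>' ?G)) (\<eta>' ?UG))"
        using obj'' map by (simp add: G.U_cmp_left \<theta>U_def)
      also have "\<dots> = \<theta>U X"
        using obj'' map by (simp add: G.triangle_U cat_ide_right[OF C])
      finally have L: "cmp C ?UG (fob U (fob G ?UG)) ?UF (fmor U (fob G ?UG) ?F ?l) (\<eta>' ?UG) = \<theta>U X" .
      have "cmp C ?UG (fob U (fob G ?UG)) ?UF (fmor U (fob G ?UG) ?F ?r) (\<eta>' ?UG) =
          cmp C ?UG (fob U (fob F ?UF)) ?UF (fmor U (fob F ?UF) ?F (\<epsilon> ?F))
            (cmp C ?UG (fob U (fob G ?UF)) (fob U (fob F ?UF)) (\<theta>U ?UF)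
              (cmp C ?UG ?UF (fob U (fob G ?UF)) (\<eta>' ?UF) (\<theta>U X)))"
        using obj'' map in_r
        by (simp add: G.U_cmp_left G.unit_nat \<theta>U_def[of "fob U (fob F X)"])
      also have "cmp C ?UG (fob U (fob G ?UF)) (fob U (fob F ?UF)) (\<theta>U ?UF)
          (cmp C ?UG ?UF (fob U (fob G ?UF)) (\<eta>' ?UF) (\<theta>U X)) =
          cmp C ?UG ?UF (fob U (fob F ?UF)) (\<eta> ?UF) (\<theta>U X)"
        using obj'' map by (simp add: cat_assoc[OF C, symmetric] \<theta>_unit)
      also have "cmp C ?UG (fob U (fob F ?UF)) ?UF (fmor U (fob F ?UF) ?F (\<epsilon> ?F)) \<dots> = \<theta>U X"
        using obj'' map F.unit_map[OF obj(5)]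
        by (simp add: cat_assoc[OF C, symmetric] F.triangle_U cat_ide_left[OF C])
      finally show "cmp C ?UG (fob U (fob G ?UG)) ?UF (fmor U (fob G ?UG) ?F ?l) (\<eta>' ?UG) =
          cmp C ?UG (fob U (fob G ?UG)) ?UF (fmor U (fob G ?UG) ?F ?r) (\<eta>' ?UG)"
        using L by simp
    qed
  qed

  show ?thesis
    unfolding isomorphic_monads_def
  proof (intro exI[of _ \<theta>U] conjI ballI)
    show "is_nat_trans C C (comp_ftr U G) (comp_ftr U F) \<theta>U"
      unfolding is_nat_trans_def
    proof (intro conjI ballI)
      show "\<theta>U X \<in> hom C (fob (comp_ftr U G) X) (fob (comp_ftr U F) X)" if "X \<in> obj C" for X
        using \<theta>U_hom[OF that] by (simp add: comp_ftr_def)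
      fix X Y f assume XY: "X \<in> obj C" "Y \<in> obj C" and f: "f \<in> hom C X Y"
      note obj = G.F_obj[OF XY(1)] G.F_obj[OF XY(2)] F.F_obj[OF XY(1)] F.F_obj[OF XY(2)]
      note map = G.F_map[OF XY f] F.F_map[OF XY f] \<theta>_hom[OF XY(1)] \<theta>_hom[OF XY(2)]
      from arg_cong[OF nat[OF XY f], of "fmor U (fob G X) (fob F Y)"]
      show "cmp C (fob (comp_ftr U G) X) (fob (comp_ftr U G) Y) (fob (comp_ftr U F) Y)
          (\<theta>U Y) (fmor (comp_ftr U G) X Y f) =
        cmp C (fob (comp_ftr U G) X) (fob (comp_ftr U F) X) (fob (comp_ftr U F) Y)
          (fmor (comp_ftr U F) X Y f) (\<theta>U X)"
        using obj map by (simp add: comp_ftr_def \<theta>U_def G.U_cmp)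
    qed
    fix X assume X: "X \<in> obj C"
    note obj = X G.F_obj[OF X] F.F_obj[OF X] U_obj[OF G.F_obj[OF X]] U_obj[OF F.F_obj[OF X]]
    note obj' = obj G.F_obj[OF obj(4)] G.F_obj[OF obj(5)] F.F_obj[OF obj(5)]
    note map = \<theta>_hom[OF X] \<theta>_hom[OF obj(5)] G.counit_map[OF obj(2)] F.counit_map[OF obj(3)]
      G.F_map[OF obj(4,5) \<theta>U_hom[OF X]]
    from arg_cong[OF mult[OF X], of "fmor U (fob G (fob U (fob G X))) (fob F X)"]
    have "cmp C (fob U (fob G (fob U (fob G X)))) (fob U (fob G X)) (fob U (fob F X))
        (\<theta>U X) (fmor U (fob G (fob U (fob G X))) (fob G X) (\<epsilon>' (fob G X))) =
      cmp C (fob U (fob G (fob U (fob G X)))) (fob U (fob F (fob U (fob F X)))) (fob U (fob F X))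
        (fmor U (fob F (fob U (fob F X))) (fob F X) (\<epsilon> (fob F X)))
        (cmp C (fob U (fob G (fob U (fob G X)))) (fob U (fob G (fob U (fob F X))))
          (fob U (fob F (fob U (fob F X)))) (\<theta>U (fob U (fob F X)))
          (fmor U (fob G (fob U (fob G X))) (fob G (fob U (fob F X)))
            (fmor G (fob U (fob G X)) (fob U (fob F X)) (\<theta>U X))))"
      using obj' map cat_cmp[OF D obj'(6,7,8) map(5,2)]
      by (simp add: \<theta>U_def[of X, symmetric] \<theta>U_def[of "fob U (fob F X)"] G.U_cmp)
    then show "let SX = fob (comp_ftr U G) X; TX = fob (comp_ftr U F) X in
        isomorphism C SX TX (\<theta>U X) \<and> cmp C X SX TX (\<theta>U X) (\<eta>' X) = \<eta> X \<and>
        cmp C (fob (comp_ftr U G) SX) SX TX (\<theta>U X) (adj_mult G U \<epsilon>' X) =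
        cmp C (fob (comp_ftr U G) SX) (fob (comp_ftr U F) TX) TX (adj_mult F U \<epsilon> X)
          (cmp C (fob (comp_ftr U G) SX) (fob (comp_ftr U G) TX) (fob (comp_ftr U F) TX) (\<theta>U TX)
            (fmor (comp_ftr U G) SX TX (\<theta>U X)))"
      using iso[OF X] \<theta>_unit[OF X] by (simp add: Let_def comp_ftr_def adj_mult_def)
  qed
qed

section \<open>Posets and monotone maps\<close>

lemma Pos_obj: "X \<in> obj Pos \<longleftrightarrow> Partial_order X \<and> small (Field X)"
  by (simp add: Pos_def)

lemma Pos_simps [simp]:
  "hom Pos X Y = mono_maps X Y"
  "ide Pos X = (\<lambda>x\<in>Field X. x)"
  "cmp Pos X Y Z g f = compose (Field X) g f"
  by (simp_all add: Pos_def)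

lemma po_refl: "Partial_order X \<Longrightarrow> x \<in> Field X \<Longrightarrow> (x, x) \<in> X"
  by (auto simp: partial_order_on_def preorder_on_def refl_on_def)

lemma po_antisym: "Partial_order X \<Longrightarrow> (x, y) \<in> X \<Longrightarrow> (y, x) \<in> X \<Longrightarrow> x = y"
  by (auto simp: partial_order_on_def antisym_def)

lemma po_trans: "Partial_order X \<Longrightarrow> (x, y) \<in> X \<Longrightarrow> (y, z) \<in> X \<Longrightarrow> (x, z) \<in> X"
  unfolding partial_order_on_def preorder_on_def by (blast dest: transD)

lemma Partial_orderI:
  assumes "\<And>x. x \<in> Field X \<Longrightarrow> (x, x) \<in> X"
    and "\<And>x y. (x, y) \<in> X \<Longrightarrow> (y, x) \<in> X \<Longrightarrow> x = y"
    and "\<And>x y z. (x, y) \<in> X \<Longrightarrow> (y, z) \<in> X \<Longrightarrow> (x, z) \<in> X"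
  shows "Partial_order X"
  using assms unfolding partial_order_on_def preorder_on_def refl_on_def antisym_def trans_def
  by (auto simp: Field_def)

lemma mono_mapsI:
  assumes "Partial_order X" and "f \<in> extensional (Field X)"
    and "\<And>x y. (x, y) \<in> X \<Longrightarrow> (f x, f y) \<in> Y"
  shows "f \<in> mono_maps X Y"
  using assms(2,3) po_refl[OF assms(1)]
  by (auto simp: mono_maps_def PiE_iff monotone_on_def intro: FieldI1)

lemma mono_maps_mono: "f \<in> mono_maps X Y \<Longrightarrow> (x, y) \<in> X \<Longrightarrow> (f x, f y) \<in> Y"
  by (auto simp: mono_maps_def monotone_on_def intro: FieldI1 FieldI2)

lemma mono_maps_Field: "f \<in> mono_maps X Y \<Longrightarrow> x \<in> Field X \<Longrightarrow> f x \<in> Field Y"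
  by (auto simp: mono_maps_def)

lemma mono_maps_ext: "f \<in> mono_maps X Y \<Longrightarrow> f \<in> extensional (Field X)"
  by (auto simp: mono_maps_def PiE_iff)

lemma mono_maps_eqI:
  assumes "f \<in> mono_maps X Y" "g \<in> mono_maps X Z" "\<And>x. x \<in> Field X \<Longrightarrow> f x = g x"
  shows "f = g"
  using assms by (auto intro: extensionalityI dest: mono_maps_ext)

lemma mono_maps_compose:
  assumes "f \<in> mono_maps X Y" "g \<in> mono_maps Y Z"
  shows "compose (Field X) g f \<in> mono_maps X Z"
  using assms by (auto simp: mono_maps_def monotone_on_def compose_def PiE_iff)

lemma restrict_mono_maps:
  assumes "\<And>x y. (x, y) \<in> X \<Longrightarrow> (f x, f y) \<in> Y" "\<And>x. x \<in> Field X \<Longrightarrow> f x \<in> Field Y"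
  shows "(\<lambda>x\<in>Field X. f x) \<in> mono_maps X Y"
  using assms by (auto simp: mono_maps_def monotone_on_def)

lemma mono_maps_ide: "X \<subseteq> Y \<Longrightarrow> (\<lambda>x\<in>Field X. x) \<in> mono_maps X Y"
  by (rule restrict_mono_maps) (auto simp: Field_def)

lemma compose_mono_maps_assoc:
  "f \<in> mono_maps W X \<Longrightarrow>
    compose (Field W) (compose (Field X) h g) f = compose (Field W) h (compose (Field W) g f)"
  by (auto simp: compose_def restrict_def fun_eq_iff mono_maps_Field)

lemma compose_mono_maps_id:
  assumes "f \<in> mono_maps X Y"
  shows "compose (Field X) f (\<lambda>x\<in>Field X. x) = f"
    and "compose (Field X) (\<lambda>x\<in>Field Y. x) f = f"
  using assms mono_maps_Field[OF assms] extensional_arb[OF mono_maps_ext[OF assms]]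
  by (auto simp: compose_def restrict_def fun_eq_iff)

lemma is_category_Pos: "is_category Pos"
  unfolding is_category_def Pos_simps
  by (intro conjI ballI compose_mono_maps_assoc compose_mono_maps_id mono_maps_ide subset_refl)
    (rule mono_maps_compose compose_mono_maps_assoc compose_mono_maps_id, assumption+)+

lemma Field_Restr:
  assumes "Partial_order X" "F \<subseteq> Field X" shows "Field (Restr X F) = F"
proof
  show "F \<subseteq> Field (Restr X F)"
    using po_refl[OF assms(1)] assms(2) by (blast intro: FieldI1)
qed (auto simp: Field_def)

lemma Partial_order_Restr:
  assumes "Partial_order X" shows "Partial_order (Restr X F)"
proof (rule Partial_orderI)
  fix x assume "x \<in> Field (Restr X F)"
  then show "(x, x) \<in> Restr X F"
    using po_refl[OF assms] unfolding Field_def by blast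
next
  show "x = y" if "(x, y) \<in> Restr X F" "(y, x) \<in> Restr X F" for x y
    using that po_antisym[OF assms] by blast
  show "(x, z) \<in> Restr X F" if "(x, y) \<in> Restr X F" "(y, z) \<in> Restr X F" for x y z
    using that po_trans[OF assms] by blast
qed

lemma small_subset: "A \<subseteq> B \<Longrightarrow> small B \<Longrightarrow> small A"
  unfolding small_def using card_of_mono1 ordLeq_ordLess_trans by blast

text \<open>The finite subsets of an infinite set are the images of its finite sequences, and there are
  no more of these than elements because an infinite set is equinumerous with its square.\<close>

lemma card_of_Fpow_infinite:
  assumes "infinite A" shows "|Fpow A| \<le>o |A|"
proof -
  define L where "L n = {xs. set xs \<subseteq> A \<and> length xs = n}" for n
  have L: "|L n| \<le>o |A|" for n
  proof (induction n)
    case 0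
    have "L 0 = {[]}" by (auto simp: L_def)
    then show ?case using assms by (simp add: card_of_singl_ordLeq infinite_imp_nonempty)
  next
    case (Suc n)
    have "L (Suc n) = (\<lambda>(x, xs). x # xs) ` (A \<times> L n)"
      by (auto simp: L_def length_Suc_conv image_iff)
    then have "|L (Suc n)| \<le>o |A \<times> L n|" by (metis card_of_image)
    also have "|A \<times> L n| \<le>o |A|"
      using card_of_Sigma_ordLeq_infinite[OF assms, of A "\<lambda>_. L n"] Suc card_of_mono1[OF subset_refl]
      by blast
    finally show ?case .
  qed
  have "Fpow A \<subseteq> set ` (\<Union>n. L n)"
    by (auto simp: Fpow_def L_def image_iff dest!: finite_list)
  then have "|Fpow A| \<le>o |set ` (\<Union>n. L n)|" by (rule card_of_mono1)
  also have "|set ` (\<Union>n. L n)| \<le>o |\<Union>n. L n|" by (rule card_of_image)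
  also have "|\<Union>n. L n| \<le>o |A|"
    by (rule card_of_UNION_ordLeq_infinite[OF assms])
      (use assms L in \<open>auto simp: infinite_iff_card_of_nat\<close>)
  finally show ?thesis .
qed

lemma small_finite:
  assumes "infinite (UNIV :: 'u set)" "finite (A :: 'u set)" shows "small A"
  unfolding small_def using assms
  by (intro finite_ordLess_infinite) (auto simp: Field_card_of card_of_well_order_on)

lemma Fpow_ordLess:
  assumes "infinite (UNIV :: 'u set)" "small (A :: 'u set)"
  shows "|Fpow A| <o |UNIV :: 'u set|"
proof (cases "finite A")
  case True
  then have "finite (Fpow A)" by (simp add: Fpow_def)
  then show ?thesis using assms
  by (intro finite_ordLess_infinite) (auto simp: Field_card_of card_of_well_order_on)
next
  case False
  then show ?thesis
    using card_of_Fpow_infinite assms(2) ordLeq_ordLess_trans unfolding small_def by blast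
qed

section \<open>Posets as directed colimits of finite posets\<close>

text \<open>A poset \<open>X\<close> is the colimit of its finite subposets. This colimit is directed, so \<open>T\<close> preserves it:
  a monotone map out of \<open>TX\<close> amounts to a compatible family of monotone maps out of the posets
  \<open>TP\<close>, where \<open>P\<close> ranges over the finite subposets of \<open>X\<close>.\<close>

lemma finitary_universal_property:
  fixes T :: "('u rel, 'u \<Rightarrow> 'u, 'u rel, 'u \<Rightarrow> 'u) ftr"
    and X Y :: "'u rel" and m :: "'u set \<Rightarrow> 'u \<Rightarrow> 'u"
  assumes inf: "infinite (UNIV :: 'u set)" and fin: "is_finitary T" and X: "X \<in> obj Pos"
    and Y: "Y \<in> obj Pos"
    and m: "\<And>F. F \<in> Fpow (Field X) \<Longrightarrow> m F \<in> mono_maps (fob T (Restr X F)) Y"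
    and comp: "\<And>F G. F \<in> Fpow (Field X) \<Longrightarrow> G \<in> Fpow (Field X) \<Longrightarrow> F \<subseteq> G \<Longrightarrow>
      compose (Field (fob T (Restr X F))) (m G) (fmor T (Restr X F) (Restr X G) (\<lambda>x\<in>F. x)) = m F"
  shows "\<exists>!h. h \<in> mono_maps (fob T X) Y \<and> (\<forall>F\<in>Fpow (Field X).
    compose (Field (fob T (Restr X F))) h (fmor T (Restr X F) X (\<lambda>x\<in>F. x)) = m F)"
proof -
  let ?P = "Fpow (Field X)"
  have PX: "Partial_order X" "small (Field X)" using X by (auto simp: Pos_obj)
  have FR: "Field (Restr X F) = F" if "F \<in> ?P" for F
    using that PX by (intro Field_Restr) (auto simp: Fpow_def)
  have "|?P| <o |UNIV :: 'u set|"
    using Fpow_ordLess[OF inf PX(2)] .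
  then obtain c :: "'u set \<Rightarrow> 'u" where c: "inj_on c ?P"
    using ordLess_imp_ordLeq card_of_ordLeq[of ?P "UNIV :: 'u set"] by blast
  define d where "d = inv_into ?P c"
  have dc: "d (c F) = F" if "F \<in> ?P" for F using that c by (simp add: d_def)
  \<comment> \<open>The objects of a small diagram are elements of the universe: \<open>c\<close> codes the finite subsets.\<close>
  define J :: "('u, 'u) cat" where
    "J = \<lparr>obj = c ` ?P, hom = (\<lambda>i j. if d i \<subseteq> d j then {undefined} else {}),
          ide = (\<lambda>_. undefined), cmp = (\<lambda>_ _ _ _ _. undefined)\<rparr>"
  define D :: "('u, 'u, 'u rel, 'u \<Rightarrow> 'u) ftr" where
    "D = \<lparr>fob = (\<lambda>i. Restr X (d i)), fmor = (\<lambda>i j _. \<lambda>x\<in>d i. x)\<rparr>"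
  have J: "obj J = c ` ?P" "hom J i j = (if d i \<subseteq> d j then {undefined} else {})"
    "ide J i = undefined" "cmp J i j k u v = undefined" for i j k u v
    by (simp_all add: J_def)
  have D: "fob D i = Restr X (d i)" "fmor D i j u = (\<lambda>x\<in>d i. x)" for i j u
    by (simp_all add: D_def)
  have catJ: "is_category J" by (auto simp: is_category_def J)
  have smJ: "small (obj J)"
    unfolding small_def J(1)
    using \<open>|?P| <o |UNIV :: 'u set|\<close> card_of_image ordLeq_ordLess_trans by blast
  have smh: "small (hom J i j)" for i j by (auto simp: J intro: small_finite[OF inf])
  have filJ: "is_filtered J"
    unfolding is_filtered_def
  proof (intro conjI ballI)
    show "obj J \<noteq> {}" by (auto simp: J Fpow_def)
  next
    fix i j assume "i \<in> obj J" "j \<in> obj J"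
    then obtain F G where FG: "F \<in> ?P" "G \<in> ?P" "i = c F" "j = c G" by (auto simp: J)
    moreover have "F \<union> G \<in> ?P" using FG by (auto simp: Fpow_def)
    ultimately show "\<exists>k\<in>obj J. hom J i k \<noteq> {} \<and> hom J j k \<noteq> {}"
      by (intro bexI[of _ "c (F \<union> G)"]) (auto simp: J dc)
  next
    fix i j f g assume "i \<in> obj J" "j \<in> obj J" "f \<in> hom J i j" "g \<in> hom J i j"
    then show "\<exists>k\<in>obj J. \<exists>h\<in>hom J j k. cmp J i j k h f = cmp J i j k h g"
      by (intro bexI[of _ j] bexI[of _ undefined]) (auto simp: J)
  qed
  have objR: "Restr X F \<in> obj Pos" if "F \<in> ?P" for F
    using that PX Partial_order_Restr[of X F] small_subset[of F "Field X"] FR[OF that]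
    by (auto simp: Fpow_def Pos_obj)
  have incl: "(\<lambda>x\<in>F. x) \<in> mono_maps (Restr X F) Z" if "F \<in> ?P" "Restr X F \<subseteq> Z" for F Z
    using mono_maps_ide[OF that(2)] FR[OF that(1)] by simp
  have incl_comp: "compose F (\<lambda>x\<in>G. x) (\<lambda>x\<in>F. x) = (\<lambda>x\<in>F. x)" if "F \<subseteq> G" for F G :: "'u set"
    using that by (auto simp: compose_def fun_eq_iff)
  have funD: "is_functor J Pos D"
    unfolding is_functor_def
    by (auto simp: J D dc FR objR incl incl_comp split: if_splits intro!: incl)
  have colD: "is_colimit J Pos D X (\<lambda>i. \<lambda>x\<in>d i. x)"
    unfolding is_colimit_def
  proof (intro conjI allI impI)
    show "is_cocone J Pos D X (\<lambda>i. \<lambda>x\<in>d i. x)"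
      unfolding is_cocone_def
      by (auto simp: J D dc FR X incl incl_comp split: if_splits)
  next
    fix Z n assume "is_cocone J Pos D Z n"
    then have Z: "Z \<in> obj Pos" and n: "\<And>F. F \<in> ?P \<Longrightarrow> n (c F) \<in> mono_maps (Restr X F) Z"
      and nn: "\<And>F G. F \<in> ?P \<Longrightarrow> G \<in> ?P \<Longrightarrow> F \<subseteq> G \<Longrightarrow>
        compose F (n (c G)) (\<lambda>x\<in>F. x) = n (c F)"
      unfolding is_cocone_def by (auto simp: J D dc FR)
    have nn': "n (c G) x = n (c F) x" if "F \<in> ?P" "G \<in> ?P" "F \<subseteq> G" "x \<in> F" for F G x
      using nn[OF that(1-3)] that(4) by (auto simp: compose_def fun_eq_iff split: if_splits)
    \<comment> \<open>Singletons determine the mediating map, and two-element subsets show that it is monotone.\<close>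
    define h where "h = (\<lambda>x\<in>Field X. n (c {x}) x)"
    have hF: "h x = n (c F) x" if "F \<in> ?P" "x \<in> F" for F x
      using nn'[of "{x}" F x] that by (auto simp: h_def Fpow_def)
    have "h \<in> mono_maps X Z"
    proof (rule mono_mapsI[OF PX(1)])
      fix x y assume xy: "(x, y) \<in> X"
      then have "{x, y} \<in> ?P" by (auto simp: Fpow_def Field_def)
      then show "(h x, h y) \<in> Z"
        using mono_maps_mono[OF n, of "{x, y}" x y] xy by (simp add: hF)
    qed (simp add: h_def)
    moreover have "compose F h (\<lambda>x\<in>F. x) = n (c F)" if "F \<in> ?P" for F
      using that n[OF that] FR[OF that] hF
      by (intro extensionalityI[of _ F]) (auto simp: compose_def dest: mono_maps_ext)
    moreover have "h' = h" if "h' \<in> mono_maps X Z"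
      "\<And>F. F \<in> ?P \<Longrightarrow> compose F h' (\<lambda>x\<in>F. x) = n (c F)" for h'
    proof (rule mono_maps_eqI[OF that(1) \<open>h \<in> mono_maps X Z\<close>])
      fix x assume "x \<in> Field X"
      then show "h' x = h x"
        using fun_cong[OF that(2)[of "{x}"], of x] by (simp add: h_def Fpow_def compose_def)
    qed
    ultimately have "\<exists>!h. h \<in> mono_maps X Z \<and> (\<forall>F\<in>?P. compose F h (\<lambda>x\<in>F. x) = n (c F))"
      by blast
    then show "\<exists>!h. h \<in> hom Pos X Z \<and>
        (\<forall>i\<in>obj J. cmp Pos (fob D i) X Z h (\<lambda>x\<in>d i. x) = n i)"
      by (simp add: J(1) D dc FR)
  qed
  have "is_colimit J Pos (comp_ftr T D) (fob T X) (\<lambda>i. fmor T (fob D i) X (\<lambda>x\<in>d i. x))"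
    using fin catJ smJ smh filJ funD colD unfolding is_finitary_def by blast
  moreover have "is_cocone J Pos (comp_ftr T D) Y (m \<circ> d)"
    unfolding is_cocone_def using Y m comp by (auto simp: J D dc comp_ftr_def)
  ultimately have "\<exists>!h. h \<in> hom Pos (fob T X) Y \<and> (\<forall>i\<in>obj J.
      cmp Pos (fob (comp_ftr T D) i) (fob T X) Y h (fmor T (fob D i) X (\<lambda>x\<in>d i. x)) = (m \<circ> d) i)"
    unfolding is_colimit_def by blast
  then show ?thesis by (simp add: J(1) D dc comp_ftr_def)
qed

text \<open>The inclusions of finite subposets are morphisms of the category of posets, so it is
  convenient to let the finite subposets of \<open>X\<close> themselves, rather than their underlying sets,
  form the directed set that indexes the colimit.\<close>

definition finite_subposets :: "'u rel \<Rightarrow> 'u rel set" where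
  "finite_subposets X = Restr X ` Fpow (Field X)"

lemma finite_subposetsD:
  assumes "X \<in> obj Pos" "P \<in> finite_subposets X"
  shows "P \<in> obj Pos" "P \<subseteq> X" "finite (Field P)" "Field P \<subseteq> Field X"
proof -
  obtain F where F: "F \<in> Fpow (Field X)" "P = Restr X F"
    using assms(2) by (auto simp: finite_subposets_def)
  have "Field P = F" using assms(1) F Field_Restr[of X F] by (simp add: Fpow_def Pos_obj)
  moreover have "small F"
    using F(1) assms(1) small_subset by (auto simp: Fpow_def Pos_obj)
  ultimately show "P \<in> obj Pos" "P \<subseteq> X" "finite (Field P)" "Field P \<subseteq> Field X"
    using assms F Partial_order_Restr[of X F] unfolding Pos_obj Fpow_def by auto
qed

lemma finite_subposet_containing:
  assumes "X \<in> obj Pos" "finite F" "F \<subseteq> Field X"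
  shows "\<exists>P\<in>finite_subposets X. Field P = F"
  using assms Field_Restr[of X F] unfolding finite_subposets_def Fpow_def Pos_obj by blast

lemma finite_subposets_directed:
  assumes "X \<in> obj Pos" "finite S" "S \<subseteq> finite_subposets X"
  shows "\<exists>R\<in>finite_subposets X. \<forall>P\<in>S. P \<subseteq> R"
proof -
  let ?F = "\<Union>(Field ` S)"
  have sub: "finite (Field P) \<and> Field P \<subseteq> Field X \<and> P \<subseteq> X" if "P \<in> S" for P
    using finite_subposetsD[OF assms(1), of P] that assms(3) by blast
  then have "?F \<in> Fpow (Field X)" using assms(2) by (auto simp: Fpow_def)
  moreover have "P \<subseteq> Restr X ?F" if "P \<in> S" for P
  proof
    fix p assume "p \<in> P"
    then have "fst p \<in> Field P" "snd p \<in> Field P" by (cases p; auto intro: FieldI1 FieldI2)+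
    then show "p \<in> Restr X ?F"
      using sub[OF that] that \<open>p \<in> P\<close> by (cases p) auto
  qed
  ultimately show ?thesis unfolding finite_subposets_def by blast
qed

section \<open>Finitary functors\<close>

text \<open>Monotone maps to a two-element chain are the up-sets. They suffice to analyse a directed
  colimit whose universal property is known.\<close>

definition chain2 :: "'u \<Rightarrow> 'u \<Rightarrow> 'u rel" where
  "chain2 a b = {(a, a), (a, b), (b, b)}"

lemma chain2_obj:
  assumes "infinite (UNIV :: 'u set)" "(a :: 'u) \<noteq> b" shows "chain2 a b \<in> obj Pos"
proof -
  have "Partial_order (chain2 a b)"
    by (rule Partial_orderI) (use assms(2) in \<open>auto simp: chain2_def Field_def\<close>)
  moreover have "finite (Field (chain2 a b))" by (simp add: chain2_def Field_def)
  ultimately show ?thesis using small_finite[OF assms(1)] by (auto simp: Pos_obj)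
qed

lemma chain2_map:
  assumes "\<And>x y. (x, y) \<in> X \<Longrightarrow> x \<in> U \<Longrightarrow> y \<in> U"
  shows "(\<lambda>x\<in>Field X. if x \<in> U then b else a) \<in> mono_maps X (chain2 a b)"
  by (rule restrict_mono_maps) (use assms in \<open>auto simp: chain2_def Field_def\<close>)

locale finitary_functor =
  fixes T :: "('u rel, 'u \<Rightarrow> 'u, 'u rel, 'u \<Rightarrow> 'u) ftr"
  assumes infinite_UNIV: "infinite (UNIV :: 'u set)"
    and functor_T: "is_functor Pos Pos T"
    and finitary_T: "is_finitary T"
begin

lemma T_obj: "X \<in> obj Pos \<Longrightarrow> fob T X \<in> obj Pos"
  using functor_T by (simp add: is_functor_def)

lemma T_map:
  "X \<in> obj Pos \<Longrightarrow> Y \<in> obj Pos \<Longrightarrow> f \<in> mono_maps X Y \<Longrightarrow>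
    fmor T X Y f \<in> mono_maps (fob T X) (fob T Y)"
  using functor_T by (simp add: is_functor_def)

lemma T_id:
  "X \<in> obj Pos \<Longrightarrow> t \<in> Field (fob T X) \<Longrightarrow> fmor T X X (\<lambda>x\<in>Field X. x) t = t"
  using functor_T by (simp add: is_functor_def)

lemma T_comp:
  assumes "X \<in> obj Pos" "Y \<in> obj Pos" "Z \<in> obj Pos" "f \<in> mono_maps X Y" "g \<in> mono_maps Y Z"
    and "t \<in> Field (fob T X)"
  shows "fmor T X Z (compose (Field X) g f) t = fmor T Y Z g (fmor T X Y f t)"
  using functor_T assms unfolding is_functor_def by (simp add: compose_eq)

text \<open>The structure maps of the directed colimit: \<open>T\<close> applied to the inclusion of \<open>P\<close> into \<open>Q\<close>.\<close>

definition emb :: "'u rel \<Rightarrow> 'u rel \<Rightarrow> 'u \<Rightarrow> 'u" where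
  "emb P Q = fmor T P Q (\<lambda>x\<in>Field P. x)"

lemma emb_map:
  "P \<in> obj Pos \<Longrightarrow> Q \<in> obj Pos \<Longrightarrow> P \<subseteq> Q \<Longrightarrow> emb P Q \<in> mono_maps (fob T P) (fob T Q)"
  unfolding emb_def by (intro T_map mono_maps_ide)

lemma emb_Field:
  "P \<in> obj Pos \<Longrightarrow> Q \<in> obj Pos \<Longrightarrow> P \<subseteq> Q \<Longrightarrow> t \<in> Field (fob T P) \<Longrightarrow>
    emb P Q t \<in> Field (fob T Q)"
  by (rule mono_maps_Field[OF emb_map])

lemma emb_trans:
  assumes "P \<in> obj Pos" "Q \<in> obj Pos" "R \<in> obj Pos" "P \<subseteq> Q" "Q \<subseteq> R" "t \<in> Field (fob T P)"
  shows "emb Q R (emb P Q t) = emb P R t"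
proof -
  have "compose (Field P) (\<lambda>x\<in>Field Q. x) (\<lambda>x\<in>Field P. x) = (\<lambda>x\<in>Field P. x)"
    using mono_Field[OF assms(4)] by (auto simp: compose_def fun_eq_iff)
  then show ?thesis
    unfolding emb_def using T_comp[OF assms(1-3) mono_maps_ide mono_maps_ide] assms(4-6) by simp
qed

lemma T_universal:
  fixes X Y :: "'u rel" and m :: "'u rel \<Rightarrow> 'u \<Rightarrow> 'u"
  assumes X: "X \<in> obj Pos" and Y: "Y \<in> obj Pos"
    and m: "\<And>P. P \<in> finite_subposets X \<Longrightarrow> m P \<in> mono_maps (fob T P) Y"
    and compat: "\<And>P Q t. P \<in> finite_subposets X \<Longrightarrow> Q \<in> finite_subposets X \<Longrightarrow> P \<subseteq> Q \<Longrightarrow>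
      t \<in> Field (fob T P) \<Longrightarrow> m Q (emb P Q t) = m P t"
  shows "\<exists>!h. h \<in> mono_maps (fob T X) Y \<and>
    (\<forall>P\<in>finite_subposets X. \<forall>t\<in>Field (fob T P). h (emb P X t) = m P t)"
proof -
  have FR: "Field (Restr X F) = F" if "F \<in> Fpow (Field X)" for F
    using that X by (intro Field_Restr) (auto simp: Fpow_def Pos_obj)
  have eq: "compose (Field (fob T P)) h g = m P \<longleftrightarrow> (\<forall>t\<in>Field (fob T P). h (g t) = m P t)"
    if "P \<in> finite_subposets X" for P h g
    using extensional_arb[OF mono_maps_ext[OF m[OF that]]]
    by (auto simp: compose_def restrict_def fun_eq_iff)
  have "\<exists>!h. h \<in> mono_maps (fob T X) Y \<and> (\<forall>F\<in>Fpow (Field X).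
    compose (Field (fob T (Restr X F))) h (fmor T (Restr X F) X (\<lambda>x\<in>F. x)) = m (Restr X F))"
  proof (rule finitary_universal_property[OF infinite_UNIV finitary_T X Y])
    show "m (Restr X F) \<in> mono_maps (fob T (Restr X F)) Y" if "F \<in> Fpow (Field X)" for F
      using m that by (simp add: finite_subposets_def)
  next
    fix F G assume FG: "F \<in> Fpow (Field X)" "G \<in> Fpow (Field X)" "F \<subseteq> G"
    then have "Restr X F \<in> finite_subposets X" "Restr X G \<in> finite_subposets X"
      "Restr X F \<subseteq> Restr X G" by (auto simp: finite_subposets_def)
    then show "compose (Field (fob T (Restr X F))) (m (Restr X G))
        (fmor T (Restr X F) (Restr X G) (\<lambda>x\<in>F. x)) = m (Restr X F)"
      using compat[of "Restr X F" "Restr X G"] FR[OF FG(1)] by (simp add: eq emb_def)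
  qed
  moreover have "(\<forall>F\<in>Fpow (Field X). compose (Field (fob T (Restr X F))) h
      (fmor T (Restr X F) X (\<lambda>x\<in>F. x)) = m (Restr X F)) \<longleftrightarrow>
    (\<forall>P\<in>finite_subposets X. \<forall>t\<in>Field (fob T P). h (emb P X t) = m P t)" for h
    by (simp add: finite_subposets_def[of X] FR emb_def eq[unfolded finite_subposets_def])
  ultimately show ?thesis by simp
qed

text \<open>If a point of \<open>TX\<close> lay outside the images of all \<open>TP\<close>, its principal up-set with and without the
  point itself would be two distinct maps to the two-element chain that agree on all images.\<close>

lemma emb_jointly_surj:
  assumes X: "X \<in> obj Pos" and t: "t \<in> Field (fob T X)"
  shows "\<exists>P\<in>finite_subposets X. \<exists>s\<in>Field (fob T P). emb P X s = t"
proof (rule ccontr)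
  assume no: "\<not> ?thesis"
  obtain a b :: 'u where ab: "a \<noteq> b"
    using infinite_UNIV by (metis finite.emptyI finite.insertI finite_subset insertI1 subsetI)
  have po: "Partial_order (fob T X)" using T_obj[OF X] by (simp add: Pos_obj)
  define U where "U = {u. (t, u) \<in> fob T X}"
  define V where "V = U - {t}"
  define h where "h W = (\<lambda>x\<in>Field (fob T X). if x \<in> W then b else a)" for W
  have h: "h U \<in> mono_maps (fob T X) (chain2 a b)" "h V \<in> mono_maps (fob T X) (chain2 a b)"
    unfolding h_def U_def V_def
    by (rule chain2_map, use po_trans[OF po] po_antisym[OF po] in blast)+
  define m where "m P = compose (Field (fob T P)) (h U) (emb P X)" for P
  have emb: "emb P X \<in> mono_maps (fob T P) (fob T X)" if "P \<in> finite_subposets X" for P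
    using that finite_subposetsD[OF X that] emb_map X by blast
  have "\<exists>!k. k \<in> mono_maps (fob T X) (chain2 a b) \<and>
    (\<forall>P\<in>finite_subposets X. \<forall>t\<in>Field (fob T P). k (emb P X t) = m P t)"
  proof (rule T_universal[OF X chain2_obj[OF infinite_UNIV ab]])
    show "m P \<in> mono_maps (fob T P) (chain2 a b)" if "P \<in> finite_subposets X" for P
      unfolding m_def using mono_maps_compose[OF emb[OF that] h(1)] .
  next
    fix P Q s assume PQ: "P \<in> finite_subposets X" "Q \<in> finite_subposets X" "P \<subseteq> Q"
      and s: "s \<in> Field (fob T P)"
    note D = finite_subposetsD[OF X PQ(1)] finite_subposetsD[OF X PQ(2)]
    show "m Q (emb P Q s) = m P s"
      using emb_trans[OF D(1,5) X PQ(3) D(6) s] emb_Field[OF D(1,5) PQ(3) s] s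
      by (simp add: m_def compose_eq)
  qed
  moreover have "h V (emb P X s) = h U (emb P X s)"
    if "P \<in> finite_subposets X" "s \<in> Field (fob T P)" for P s
    using no that by (auto simp: h_def V_def)
  ultimately have "h U = h V" using h by (auto simp: m_def compose_eq)
  then have "h U t = h V t" by simp
  then show False using t ab po_refl[OF po t] by (simp add: h_def U_def V_def)
qed

text \<open>Let \<open>U R\<close> consist of the elements of \<open>TR\<close> whose image in some larger \<open>TQ\<close> is above that of \<open>s\<close>.
  These up-sets are compatible with the inclusions, so the universal property turns them into one
  up-set of \<open>TX\<close>. It contains the image of \<open>s\<close>, hence that of \<open>t\<close>, which means that \<open>t\<close> belongs to
  \<open>U P\<close>.\<close>

lemma emb_reflects_order:
  assumes X: "X \<in> obj Pos" and P: "P \<in> finite_subposets X"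
    and st: "s \<in> Field (fob T P)" "t \<in> Field (fob T P)" "(emb P X s, emb P X t) \<in> fob T X"
  shows "\<exists>Q\<in>finite_subposets X. P \<subseteq> Q \<and> (emb P Q s, emb P Q t) \<in> fob T Q"
proof -
  obtain a b :: 'u where ab: "a \<noteq> b"
    using infinite_UNIV by (metis finite.emptyI finite.insertI finite_subset insertI1 subsetI)
  let ?S = "finite_subposets X"
  have obj: "R \<in> obj Pos" if "R \<in> ?S" for R using finite_subposetsD[OF X that] by blast
  have po: "Partial_order (fob T R)" if "R \<in> ?S" for R
    using T_obj[OF obj[OF that]] by (simp add: Pos_obj)
  have dir: "\<exists>R\<in>?S. Q \<subseteq> R \<and> Q' \<subseteq> R" if "Q \<in> ?S" "Q' \<in> ?S" for Q Q'
    using finite_subposets_directed[OF X, of "{Q, Q'}"] that by auto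
  define U where "U R = {u \<in> Field (fob T R). \<exists>Q\<in>?S. P \<subseteq> Q \<and> R \<subseteq> Q \<and>
    (emb P Q s, emb R Q u) \<in> fob T Q}" for R
  define m where "m R = (\<lambda>u\<in>Field (fob T R). if u \<in> U R then b else a)" for R
  have mono: "(emb Q R u, emb Q R v) \<in> fob T R"
    if "Q \<in> ?S" "R \<in> ?S" "Q \<subseteq> R" "(u, v) \<in> fob T Q" for Q R u v
    using mono_maps_mono[OF emb_map that(4)] obj that by blast
  have emb_Field: "emb Q R u \<in> Field (fob T R)"
    if "Q \<in> ?S" "R \<in> ?S" "Q \<subseteq> R" "u \<in> Field (fob T Q)" for Q R u
    using emb_Field[OF obj obj] that by blast
  have "\<exists>!k. k \<in> mono_maps (fob T X) (chain2 a b) \<and>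
    (\<forall>R\<in>?S. \<forall>u\<in>Field (fob T R). k (emb R X u) = m R u)"
  proof (rule T_universal[OF X chain2_obj[OF infinite_UNIV ab]])
    fix R assume R: "R \<in> ?S"
    show "m R \<in> mono_maps (fob T R) (chain2 a b)"
      unfolding m_def
    proof (rule chain2_map)
      fix u v assume uv: "(u, v) \<in> fob T R" "u \<in> U R"
      then obtain Q where Q: "Q \<in> ?S" "P \<subseteq> Q" "R \<subseteq> Q" "(emb P Q s, emb R Q u) \<in> fob T Q"
        by (auto simp: U_def)
      have "(emb P Q s, emb R Q v) \<in> fob T Q"
        using po_trans[OF po[OF Q(1)] Q(4) mono[OF R Q(1,3) uv(1)]] .
      then show "v \<in> U R" using Q uv by (auto simp: U_def intro: FieldI2)
    qed
  next
    fix R R' u assume R: "R \<in> ?S" "R' \<in> ?S" "R \<subseteq> R'" and u: "u \<in> Field (fob T R)"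
    have "emb R R' u \<in> U R' \<longleftrightarrow> u \<in> U R"
    proof
      assume "emb R R' u \<in> U R'"
      then obtain Q where Q: "Q \<in> ?S" "P \<subseteq> Q" "R' \<subseteq> Q"
        "(emb P Q s, emb R' Q (emb R R' u)) \<in> fob T Q" by (auto simp: U_def)
      moreover have "emb R' Q (emb R R' u) = emb R Q u"
        using emb_trans obj R Q u by simp
      ultimately show "u \<in> U R" using R u by (auto simp: U_def)
    next
      assume "u \<in> U R"
      then obtain Q where Q: "Q \<in> ?S" "P \<subseteq> Q" "R \<subseteq> Q" "(emb P Q s, emb R Q u) \<in> fob T Q"
        by (auto simp: U_def)
      obtain Q' where Q': "Q' \<in> ?S" "Q \<subseteq> Q'" "R' \<subseteq> Q'" using dir[OF Q(1) R(2)] by blast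
      have "emb Q Q' (emb P Q s) = emb P Q' s" "emb Q Q' (emb R Q u) = emb R Q' u"
        "emb R' Q' (emb R R' u) = emb R Q' u"
        using emb_trans obj P R Q Q' u st(1) by auto
      then have "(emb P Q' s, emb R' Q' (emb R R' u)) \<in> fob T Q'"
        using mono[OF Q(1) Q'(1,2) Q(4)] by simp
      moreover have "P \<subseteq> Q'" using Q Q' by blast
      ultimately show "emb R R' u \<in> U R'"
        using emb_Field R u Q' by (auto simp: U_def)
    qed
    then show "m R' (emb R R' u) = m R u"
      using emb_Field R u by (simp add: m_def)
  qed
  then obtain k where k: "k \<in> mono_maps (fob T X) (chain2 a b)"
    and km: "\<And>R u. R \<in> ?S \<Longrightarrow> u \<in> Field (fob T R) \<Longrightarrow> k (emb R X u) = m R u" by blast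
  have "emb P P s \<in> Field (fob T P)" using emb_Field P st by blast
  then have "s \<in> U P" using P st po_refl[OF po[OF P]] by (auto simp: U_def)
  then have "k (emb P X s) = b" using km P st by (simp add: m_def)
  then have "(b, k (emb P X t)) \<in> chain2 a b" using mono_maps_mono[OF k st(3)] by simp
  then have "k (emb P X t) = b" using ab by (auto simp: chain2_def)
  then have "t \<in> U P" using km[OF P st(2)] ab st(2) by (auto simp: m_def split: if_splits)
  then show ?thesis by (auto simp: U_def)
qed

text \<open>Finite posets are finitely presentable: a monotone map from a finite poset to \<open>TX\<close> involves
  finitely many elements and finitely many inequalities, and by directedness one finite subposet
  serves all of them.\<close>

lemma finite_map_factors:
  assumes X: "X \<in> obj Pos" and G: "Partial_order G" "finite (Field G)"
    and f: "f \<in> mono_maps G (fob T X)"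
  shows "\<exists>P\<in>finite_subposets X. \<exists>f'\<in>mono_maps G (fob T P). \<forall>i\<in>Field G. emb P X (f' i) = f i"
proof -
  let ?S = "finite_subposets X"
  have obj: "R \<in> obj Pos" if "R \<in> ?S" for R using finite_subposetsD[OF X that] by blast
  have sub: "R \<subseteq> X" if "R \<in> ?S" for R using finite_subposetsD[OF X that] by blast
  have "\<forall>i\<in>Field G. \<exists>P s. P \<in> ?S \<and> s \<in> Field (fob T P) \<and> emb P X s = f i"
    using emb_jointly_surj[OF X] mono_maps_Field[OF f] by blast
  then obtain p s where ps: "\<And>i. i \<in> Field G \<Longrightarrow>
      p i \<in> ?S \<and> s i \<in> Field (fob T (p i)) \<and> emb (p i) X (s i) = f i"
    by metis
  have "p ` Field G \<subseteq> ?S" using ps by blast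
  then obtain P where P: "P \<in> ?S" "\<And>i. i \<in> Field G \<Longrightarrow> p i \<subseteq> P"
    using finite_subposets_directed[OF X, of "p ` Field G"] G(2) by auto
  define g where "g i = emb (p i) P (s i)" for i
  have g: "g i \<in> Field (fob T P)" "emb P X (g i) = f i" if "i \<in> Field G" for i
    using mono_maps_Field[OF emb_map, of "p i" P "s i"] emb_trans[of "p i" P X "s i"]
      ps[OF that] P(1) P(2)[OF that] obj X sub by (auto simp: g_def)
  have "\<forall>ij\<in>G. \<exists>Q. Q \<in> ?S \<and> P \<subseteq> Q \<and> (emb P Q (g (fst ij)), emb P Q (g (snd ij))) \<in> fob T Q"
  proof
    fix ij assume ij: "ij \<in> G"
    then have "fst ij \<in> Field G" "snd ij \<in> Field G"
      by (auto simp: Field_def Domain_fst Range_snd)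
    moreover have "(f (fst ij), f (snd ij)) \<in> fob T X" using mono_maps_mono[OF f] ij by simp
    ultimately show "\<exists>Q. Q \<in> ?S \<and> P \<subseteq> Q \<and>
        (emb P Q (g (fst ij)), emb P Q (g (snd ij))) \<in> fob T Q"
      using emb_reflects_order[OF X P(1), of "g (fst ij)" "g (snd ij)"] g by auto
  qed
  then obtain q where q: "\<And>ij. ij \<in> G \<Longrightarrow> q ij \<in> ?S \<and> P \<subseteq> q ij \<and>
      (emb P (q ij) (g (fst ij)), emb P (q ij) (g (snd ij))) \<in> fob T (q ij)"
    by metis
  have "G \<subseteq> Field G \<times> Field G" by (auto simp: Field_def)
  then have "finite G" using finite_subset G(2) by blast
  moreover have "insert P (q ` G) \<subseteq> ?S" using P(1) q by blast
  ultimately obtain R where R: "R \<in> ?S" "\<And>Q. Q \<in> insert P (q ` G) \<Longrightarrow> Q \<subseteq> R"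
    using finite_subposets_directed[OF X, of "insert P (q ` G)"] by (metis finite_imageI finite_insert)
  define f' where "f' = (\<lambda>i\<in>Field G. emb P R (g i))"
  have "f' \<in> mono_maps G (fob T R)"
    unfolding f'_def
  proof (rule restrict_mono_maps)
    fix i j assume ij: "(i, j) \<in> G"
    then have "i \<in> Field G" "j \<in> Field G" by (auto intro: FieldI1 FieldI2)
    then have "emb (q (i, j)) R (emb P (q (i, j)) (g i)) = emb P R (g i)"
      "emb (q (i, j)) R (emb P (q (i, j)) (g j)) = emb P R (g j)"
      using emb_trans[of P "q (i, j)" R] q[OF ij] R ij P(1) obj g by auto
    then show "(emb P R (g i), emb P R (g j)) \<in> fob T R"
      using mono_maps_mono[OF emb_map, of "q (i, j)" R] q[OF ij] R ij obj by force
  qed (use mono_maps_Field[OF emb_map, of P R] P(1) R obj g in auto)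
  moreover have "emb R X (f' i) = f i" if "i \<in> Field G" for i
    using that g emb_trans[of P R X "g i"] P(1) R obj X sub by (simp add: f'_def)
  ultimately show ?thesis using R(1) by blast
qed

end

section \<open>Finitary monads and Kleisli extension\<close>

locale finitary_monad = finitary_functor T
  for T :: "('u rel, 'u \<Rightarrow> 'u, 'u rel, 'u \<Rightarrow> 'u) ftr" +
  fixes ctx :: "'u rel set" and \<eta> \<mu> :: "'u rel \<Rightarrow> 'u \<Rightarrow> 'u"
  assumes monad: "is_monad Pos T \<eta> \<mu>" and ctx: "is_context_set ctx"
begin

lemma eta_map: "X \<in> obj Pos \<Longrightarrow> \<eta> X \<in> mono_maps X (fob T X)"
  using monad by (simp add: is_monad_def is_nat_trans_def id_ftr_def)

lemma mu_map: "X \<in> obj Pos \<Longrightarrow> \<mu> X \<in> mono_maps (fob T (fob T X)) (fob T X)"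
  using monad by (simp add: is_monad_def is_nat_trans_def comp_ftr_def)

lemma eta_nat:
  assumes "X \<in> obj Pos" "Y \<in> obj Pos" "f \<in> mono_maps X Y" "x \<in> Field X"
  shows "fmor T X Y f (\<eta> X x) = \<eta> Y (f x)"
proof -
  have "compose (Field X) (\<eta> Y) f = compose (Field X) (fmor T X Y f) (\<eta> X)"
    using monad assms(1-3) by (simp add: is_monad_def is_nat_trans_def id_ftr_def)
  from fun_cong[OF this, of x] show ?thesis using assms(4) by (simp add: compose_eq)
qed

lemma mu_nat:
  assumes "X \<in> obj Pos" "Y \<in> obj Pos" "f \<in> mono_maps X Y" "t \<in> Field (fob T (fob T X))"
  shows "\<mu> Y (fmor T (fob T X) (fob T Y) (fmor T X Y f) t) = fmor T X Y f (\<mu> X t)"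
proof -
  have "compose (Field (fob T (fob T X))) (\<mu> Y) (fmor T (fob T X) (fob T Y) (fmor T X Y f)) =
      compose (Field (fob T (fob T X))) (fmor T X Y f) (\<mu> X)"
    using monad assms(1-3) by (simp add: is_monad_def is_nat_trans_def comp_ftr_def)
  from fun_cong[OF this, of t] show ?thesis using assms(4) by (simp add: compose_eq)
qed

lemma monad_laws:
  assumes "X \<in> obj Pos"
  shows mu_eta: "t \<in> Field (fob T X) \<Longrightarrow> \<mu> X (\<eta> (fob T X) t) = t"
    and mu_T_eta: "t \<in> Field (fob T X) \<Longrightarrow> \<mu> X (fmor T X (fob T X) (\<eta> X) t) = t"
    and mu_mu: "u \<in> Field (fob T (fob T (fob T X))) \<Longrightarrow>
      \<mu> X (\<mu> (fob T X) u) = \<mu> X (fmor T (fob T (fob T X)) (fob T X) (\<mu> X) u)"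
proof -
  let ?T1 = "fob T X" and ?T3 = "fob T (fob T (fob T X))"
  have "compose (Field ?T1) (\<mu> X) (\<eta> ?T1) = (\<lambda>x\<in>Field ?T1. x)"
    "compose (Field ?T1) (\<mu> X) (fmor T X ?T1 (\<eta> X)) = (\<lambda>x\<in>Field ?T1. x)"
    "compose (Field ?T3) (\<mu> X) (\<mu> ?T1) =
     compose (Field ?T3) (\<mu> X) (fmor T (fob T ?T1) ?T1 (\<mu> X))"
    using monad assms by (simp_all add: is_monad_def Let_def)
  note this[THEN fun_cong]
  from this(1)[of t] this(2)[of t] this(3)[of u] show
    "t \<in> Field (fob T X) \<Longrightarrow> \<mu> X (\<eta> (fob T X) t) = t"
    "t \<in> Field (fob T X) \<Longrightarrow> \<mu> X (fmor T X (fob T X) (\<eta> X) t) = t"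
    "u \<in> Field (fob T (fob T (fob T X))) \<Longrightarrow>
      \<mu> X (\<mu> (fob T X) u) = \<mu> X (fmor T (fob T (fob T X)) (fob T X) (\<mu> X) u)"
    by (simp_all add: compose_eq)
qed

abbreviation kl :: "'u rel \<Rightarrow> 'u rel \<Rightarrow> ('u \<Rightarrow> 'u) \<Rightarrow> 'u \<Rightarrow> 'u" where
  "kl \<equiv> kleisli_ext T \<mu>"

lemma kl_eq: "t \<in> Field (fob T X) \<Longrightarrow> kl X Y k t = \<mu> Y (fmor T X (fob T Y) k t)"
  by (simp add: kleisli_ext_def compose_eq)

lemma kl_map:
  assumes "X \<in> obj Pos" "Y \<in> obj Pos" "k \<in> mono_maps X (fob T Y)"
  shows "kl X Y k \<in> mono_maps (fob T X) (fob T Y)"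
  unfolding kleisli_ext_def
  using mono_maps_compose[OF T_map[OF assms(1) T_obj[OF assms(2)] assms(3)] mu_map[OF assms(2)]]
  by simp

lemma kl_Field:
  assumes "X \<in> obj Pos" "Y \<in> obj Pos" "k \<in> mono_maps X (fob T Y)" "t \<in> Field (fob T X)"
  shows "kl X Y k t \<in> Field (fob T Y)"
  by (rule mono_maps_Field[OF kl_map[OF assms(1-3)] assms(4)])

lemma kl_eta:
  assumes "X \<in> obj Pos" "Y \<in> obj Pos" "k \<in> mono_maps X (fob T Y)" "x \<in> Field X"
  shows "kl X Y k (\<eta> X x) = k x"
  using assms eta_nat[OF assms(1) T_obj[OF assms(2)] assms(3,4)]
    mono_maps_Field[OF eta_map[OF assms(1)] assms(4)] mono_maps_Field[OF assms(3,4)]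
  by (simp add: kl_eq mu_eta)

text \<open>Precomposition with a map of posets, postcomposition with \<open>Tg\<close>, and composition in the
  Kleisli category are all absorbed into one Kleisli extension.\<close>

lemma kl_T:
  assumes "X \<in> obj Pos" "Y \<in> obj Pos" "Z \<in> obj Pos" "f \<in> mono_maps X Y"
    "k \<in> mono_maps Y (fob T Z)" "t \<in> Field (fob T X)"
  shows "kl Y Z k (fmor T X Y f t) = kl X Z (compose (Field X) k f) t"
  using assms T_comp[OF assms(1,2) T_obj[OF assms(3)] assms(4-6)]
    mono_maps_Field[OF T_map[OF assms(1,2,4)] assms(6)]
  by (simp add: kl_eq)

lemma T_kl:
  assumes "X \<in> obj Pos" "Y \<in> obj Pos" "Z \<in> obj Pos" "k \<in> mono_maps X (fob T Y)"
    "g \<in> mono_maps Y Z" "t \<in> Field (fob T X)"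
  shows "fmor T Y Z g (kl X Y k t) = kl X Z (compose (Field X) (fmor T Y Z g) k) t"
  using assms
    T_comp[OF assms(1) T_obj[OF assms(2)] T_obj[OF assms(3)] assms(4) T_map[OF assms(2,3,5)] assms(6)]
    mono_maps_Field[OF T_map[OF assms(1) T_obj[OF assms(2)] assms(4)] assms(6)] mu_nat[OF assms(2,3,5)]
  by (simp add: kl_eq)

lemma kl_kl:
  assumes "X \<in> obj Pos" "Y \<in> obj Pos" "Z \<in> obj Pos" "k \<in> mono_maps X (fob T Y)"
    "l \<in> mono_maps Y (fob T Z)" "t \<in> Field (fob T X)"
  shows "kl Y Z l (kl X Y k t) = kl X Z (compose (Field X) (kl Y Z l) k) t"
proof -
  note [simp] = T_obj assms(1-3)
  have kt: "fmor T X (fob T Y) k t \<in> Field (fob T (fob T Y))"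
    using mono_maps_Field[OF T_map] assms by auto
  have lt: "fmor T (fob T Y) (fob T (fob T Z)) (fmor T Y (fob T Z) l) (fmor T X (fob T Y) k t)
      \<in> Field (fob T (fob T (fob T Z)))"
    using mono_maps_Field[OF T_map[OF _ _ T_map]] kt assms by auto
  have "kl Y Z l (kl X Y k t) = \<mu> Z (fmor T Y (fob T Z) l (\<mu> Y (fmor T X (fob T Y) k t)))"
    using kl_Field assms by (simp add: kl_eq)
  also have "\<dots> = \<mu> Z (\<mu> (fob T Z) (fmor T (fob T Y) (fob T (fob T Z)) (fmor T Y (fob T Z) l)
      (fmor T X (fob T Y) k t)))"
    using mu_nat[OF _ _ assms(5) kt] by simp
  also have "\<dots> = \<mu> Z (fmor T (fob T (fob T Z)) (fob T Z) (\<mu> Z)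
      (fmor T (fob T Y) (fob T (fob T Z)) (fmor T Y (fob T Z) l) (fmor T X (fob T Y) k t)))"
    using mu_mu[OF assms(3) lt] .
  also have "\<dots> = \<mu> Z (fmor T (fob T Y) (fob T Z) (kl Y Z l) (fmor T X (fob T Y) k t))"
    using T_comp[OF _ _ _ T_map[OF _ _ assms(5)] mu_map kt] by (simp add: kleisli_ext_def)
  also have "\<dots> = kl X Z (compose (Field X) (kl Y Z l) k) t"
    using T_comp[OF _ _ _ assms(4) kl_map[OF _ _ assms(5)] assms(6)] assms(6) by (simp add: kl_eq)
  finally show ?thesis .
qed

lemma T_eq_kl:
  assumes "X \<in> obj Pos" "Y \<in> obj Pos" "f \<in> mono_maps X Y" "t \<in> Field (fob T X)"
  shows "fmor T X Y f t = kl X Y (compose (Field X) (\<eta> Y) f) t"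
  using assms T_comp[OF assms(1,2) T_obj[OF assms(2)] assms(3) eta_map[OF assms(2)] assms(4)]
    mono_maps_Field[OF T_map[OF assms(1-3)] assms(4)]
  by (simp add: kl_eq mu_T_eta)

lemma kl_id:
  assumes "X \<in> obj Pos" "t \<in> Field (fob T (fob T X))"
  shows "kl (fob T X) X (\<lambda>x\<in>Field (fob T X). x) t = \<mu> X t"
  using assms T_id[OF T_obj[OF assms(1)] assms(2)] by (simp add: kl_eq)

section \<open>The associated variety\<close>

abbreviation "\<Sigma> \<equiv> assoc_sig T"
abbreviation "\<V> \<equiv> variety ctx \<Sigma> (assoc_ineqs ctx T \<eta> \<mu>)"

lemma ctxD:
  assumes "\<Gamma> \<in> ctx"
  shows ctx_obj: "\<Gamma> \<in> obj Pos" and ctx_finite: "finite (Field \<Gamma>)"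
  using assms ctx small_finite[OF infinite_UNIV] by (auto simp: is_context_set_def Pos_obj)

lemma eval_Op:
  assumes h: "h \<in> mono_maps \<Delta> (poset A)"
    and g: "\<And>i. i \<in> Field \<Delta> \<Longrightarrow> eval A f (g i) = Some (h i)"
  shows "eval A f (Op \<Delta> \<sigma> g) = Some (oper A \<Delta> \<sigma> h)"
proof -
  have "(\<lambda>i\<in>Field \<Delta>. the (eval A f (g i))) = h"
    using g extensional_arb[OF mono_maps_ext[OF h]] by (auto simp: fun_eq_iff)
  moreover have "(the (eval A f (g i)), the (eval A f (g j))) \<in> poset A" if "(i, j) \<in> \<Delta>" for i j
    using g[OF FieldI1[OF that]] g[OF FieldI2[OF that]] mono_maps_mono[OF h that] by simp
  ultimately show ?thesis using g by fastforce
qed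

lemma eval_op_term:
  assumes "f \<in> mono_maps \<Gamma> (poset A)"
  shows "eval A f (op_term \<Gamma> \<sigma>) = Some (oper A \<Gamma> \<sigma> f)"
  unfolding op_term_def by (rule eval_Op[OF assms]) simp

lemma eval_op_subst:
  assumes f: "f \<in> mono_maps \<Gamma> (poset A)" and k: "k \<in> mono_maps \<Delta> (fob T \<Gamma>)"
    and ord: "\<And>\<sigma> \<tau>. (\<sigma>, \<tau>) \<in> fob T \<Gamma> \<Longrightarrow> (oper A \<Gamma> \<sigma> f, oper A \<Gamma> \<tau> f) \<in> poset A"
    and fld: "\<And>\<sigma>. \<sigma> \<in> Field (fob T \<Gamma>) \<Longrightarrow> oper A \<Gamma> \<sigma> f \<in> Field (poset A)"
  shows "eval A f (Op \<Delta> \<sigma> (\<lambda>i\<in>Field \<Delta>. op_term \<Gamma> (k i))) =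
    Some (oper A \<Delta> \<sigma> (\<lambda>i\<in>Field \<Delta>. oper A \<Gamma> (k i) f))"
proof (rule eval_Op)
  show "(\<lambda>i\<in>Field \<Delta>. oper A \<Gamma> (k i) f) \<in> mono_maps \<Delta> (poset A)"
    by (rule restrict_mono_maps[OF ord[OF mono_maps_mono[OF k]] fld[OF mono_maps_Field[OF k]]])
qed (simp add: eval_op_term[OF f])

lemma Alg_obj:
  assumes "A \<in> obj (Alg ctx \<Sigma>)"
  shows "poset A \<in> obj Pos"
    and "\<Gamma> \<in> ctx \<Longrightarrow> \<sigma> \<in> Field (fob T \<Gamma>) \<Longrightarrow> f \<in> mono_maps \<Gamma> (poset A) \<Longrightarrow>
      oper A \<Gamma> \<sigma> f \<in> Field (poset A)"
  using assms by (fastforce simp: Alg_def assoc_sig_def)+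

text \<open>All terms in the defining inequations are defined in every algebra that satisfies the
  inequations between operation symbols; the variety is therefore given by total laws.\<close>

lemma satisfies_assoc_ineqs:
  assumes A: "A \<in> obj (Alg ctx \<Sigma>)"
  shows "(\<forall>e\<in>assoc_ineqs ctx T \<eta> \<mu>. satisfies A e) \<longleftrightarrow>
    (\<forall>\<Gamma>\<in>ctx. \<forall>f\<in>mono_maps \<Gamma> (poset A).
      (\<forall>\<sigma> \<tau>. (\<sigma>, \<tau>) \<in> fob T \<Gamma> \<longrightarrow> (oper A \<Gamma> \<sigma> f, oper A \<Gamma> \<tau> f) \<in> poset A) \<and>
      (\<forall>\<Delta>\<in>ctx. \<forall>k\<in>mono_maps \<Delta> (fob T \<Gamma>). \<forall>\<sigma>\<in>Field (fob T \<Delta>).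
        oper A \<Gamma> (kl \<Delta> \<Gamma> k \<sigma>) f = oper A \<Delta> \<sigma> (\<lambda>i\<in>Field \<Delta>. oper A \<Gamma> (k i) f)) \<and>
      (\<forall>x\<in>Field \<Gamma>. oper A \<Gamma> (\<eta> \<Gamma> x) f = f x))"
    (is "?S \<longleftrightarrow> ?R")
proof
  assume S: ?S
  have po: "Partial_order (poset A)" using Alg_obj(1)[OF A] by (simp add: Pos_obj)
  have ord: "(oper A \<Gamma> \<sigma> f, oper A \<Gamma> \<tau> f) \<in> poset A"
    if "\<Gamma> \<in> ctx" "f \<in> mono_maps \<Gamma> (poset A)" "(\<sigma>, \<tau>) \<in> fob T \<Gamma>" for \<Gamma> f \<sigma> \<tau>
  proof -
    have "(\<Gamma>, op_term \<Gamma> \<sigma>, op_term \<Gamma> \<tau>) \<in> assoc_ineqs ctx T \<eta> \<mu>"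
      using that by (auto simp: assoc_ineqs_def order_ineqs_def)
    then have "satisfies A (\<Gamma>, op_term \<Gamma> \<sigma>, op_term \<Gamma> \<tau>)" using S by blast
    then show ?thesis using that(2) by (simp add: satisfies_def eval_op_term)
  qed
  have eq: "a = b"
    if "equation \<Gamma> s t \<subseteq> assoc_ineqs ctx T \<eta> \<mu>" "f \<in> mono_maps \<Gamma> (poset A)"
      "eval A f s = Some a" "eval A f t = Some b" for \<Gamma> s t f a b
  proof -
    have "satisfies A (\<Gamma>, s, t)" "satisfies A (\<Gamma>, t, s)"
      using S that(1) unfolding equation_def by blast+
    then have "(a, b) \<in> poset A" "(b, a) \<in> poset A" using that(2-4) by (auto simp: satisfies_def)
    then show ?thesis by (rule po_antisym[OF po])
  qed
  show ?R
  proof (intro ballI conjI allI impI)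
    fix \<Gamma> f assume G: "\<Gamma> \<in> ctx" and f: "f \<in> mono_maps \<Gamma> (poset A)"
    show "(oper A \<Gamma> \<sigma> f, oper A \<Gamma> \<tau> f) \<in> poset A" if "(\<sigma>, \<tau>) \<in> fob T \<Gamma>" for \<sigma> \<tau>
      using ord[OF G f that] .
    show "oper A \<Gamma> (\<eta> \<Gamma> x) f = f x" if "x \<in> Field \<Gamma>" for x
    proof -
      have "equation \<Gamma> (op_term \<Gamma> (\<eta> \<Gamma> x)) (Var x) \<subseteq> assoc_ineqs ctx T \<eta> \<mu>"
        using G that unfolding assoc_ineqs_def unit_eqs_def by blast
      from eq[OF this f eval_op_term[OF f] eval.simps(1)] show ?thesis by simp
    qed
    fix \<Delta> k \<sigma> assume D: "\<Delta> \<in> ctx" "k \<in> mono_maps \<Delta> (fob T \<Gamma>)" "\<sigma> \<in> Field (fob T \<Delta>)"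
    then have "equation \<Gamma> (op_term \<Gamma> (kl \<Delta> \<Gamma> k \<sigma>)) (Op \<Delta> \<sigma> (\<lambda>i\<in>Field \<Delta>. op_term \<Gamma> (k i)))
        \<subseteq> assoc_ineqs ctx T \<eta> \<mu>"
      using G unfolding assoc_ineqs_def subst_eqs_def by blast
    from eq[OF this f eval_op_term[OF f] eval_op_subst[OF f D(2) ord[OF G f] Alg_obj(2)[OF A G _ f]]]
    show "oper A \<Gamma> (kl \<Delta> \<Gamma> k \<sigma>) f = oper A \<Delta> \<sigma> (\<lambda>i\<in>Field \<Delta>. oper A \<Gamma> (k i) f)" by simp
  qed
next
  assume R: ?R
  have po: "Partial_order (poset A)" using Alg_obj(1)[OF A] by (simp add: Pos_obj)
  have sat: "satisfies A e"
    if "e \<in> equation \<Gamma> s t"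
      "\<And>f. f \<in> mono_maps \<Gamma> (poset A) \<Longrightarrow>
        \<exists>a\<in>Field (poset A). eval A f s = Some a \<and> eval A f t = Some a" for e \<Gamma> s t
    using that po_refl[OF po] unfolding equation_def satisfies_def by fastforce
  show ?S
  proof
    fix e assume "e \<in> assoc_ineqs ctx T \<eta> \<mu>"
    then consider
      (1) \<Gamma> \<sigma> \<tau> where "e = (\<Gamma>, op_term \<Gamma> \<sigma>, op_term \<Gamma> \<tau>)" "\<Gamma> \<in> ctx" "(\<sigma>, \<tau>) \<in> fob T \<Gamma>"
    | (2) \<Gamma> \<Delta> k \<sigma> where "\<Gamma> \<in> ctx" "\<Delta> \<in> ctx" "k \<in> mono_maps \<Delta> (fob T \<Gamma>)"
        "\<sigma> \<in> Field (fob T \<Delta>)" "e \<in> equation \<Gamma> (op_term \<Gamma> (kl \<Delta> \<Gamma> k \<sigma>))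
                   (Op \<Delta> \<sigma> (\<lambda>i\<in>Field \<Delta>. op_term \<Gamma> (k i)))"
    | (3) \<Gamma> x where "\<Gamma> \<in> ctx" "x \<in> Field \<Gamma>" "e \<in> equation \<Gamma> (op_term \<Gamma> (\<eta> \<Gamma> x)) (Var x)"
      unfolding assoc_ineqs_def order_ineqs_def subst_eqs_def unit_eqs_def by blast
    then show "satisfies A e"
    proof cases
      case 1
      then show ?thesis using R by (simp add: satisfies_def eval_op_term)
    next
      case 2
      show ?thesis
      proof (rule sat[OF 2(5)])
        fix f assume f: "f \<in> mono_maps \<Gamma> (poset A)"
        have ord: "(oper A \<Gamma> \<sigma> f, oper A \<Gamma> \<tau> f) \<in> poset A" if "(\<sigma>, \<tau>) \<in> fob T \<Gamma>" for \<sigma> \<tau>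
          using R 2(1) f that by blast
        have "oper A \<Gamma> (kl \<Delta> \<Gamma> k \<sigma>) f = oper A \<Delta> \<sigma> (\<lambda>i\<in>Field \<Delta>. oper A \<Gamma> (k i) f)"
          using R 2(1-4) f by blast
        moreover have "oper A \<Gamma> (kl \<Delta> \<Gamma> k \<sigma>) f \<in> Field (poset A)"
          using Alg_obj(2)[OF A 2(1) kl_Field f] ctx_obj 2 by blast
        ultimately show "\<exists>a\<in>Field (poset A). eval A f (op_term \<Gamma> (kl \<Delta> \<Gamma> k \<sigma>)) = Some a \<and>
          eval A f (Op \<Delta> \<sigma> (\<lambda>i\<in>Field \<Delta>. op_term \<Gamma> (k i))) = Some a"
          using eval_op_term[OF f] eval_op_subst[OF f 2(3) ord Alg_obj(2)[OF A 2(1) _ f]] by auto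
      qed
    next
      case 3
      show ?thesis
      proof (rule sat[OF 3(3)])
        fix f assume f: "f \<in> mono_maps \<Gamma> (poset A)"
        have "oper A \<Gamma> (\<eta> \<Gamma> x) f = f x" using R 3(1,2) f by blast
        then show "\<exists>a\<in>Field (poset A). eval A f (op_term \<Gamma> (\<eta> \<Gamma> x)) = Some a \<and>
          eval A f (Var x) = Some a"
          using eval_op_term[OF f] mono_maps_Field[OF f 3(2)] by auto
      qed
    qed
  qed
qed

lemma assoc_ineqs_subset: "assoc_ineqs ctx T \<eta> \<mu> \<subseteq> inequations ctx \<Sigma>"
proof -
  have op: "op_term \<Gamma> \<sigma> \<in> terms ctx \<Sigma> \<Gamma>" if "\<Gamma> \<in> ctx" "\<sigma> \<in> Field (fob T \<Gamma>)" for \<Gamma> \<sigma>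
    unfolding op_term_def using that
    by (intro terms.Op) (auto simp: assoc_sig_def intro: terms.Var)
  have sub: "Op \<Delta> \<sigma> (\<lambda>i\<in>Field \<Delta>. op_term \<Gamma> (k i)) \<in> terms ctx \<Sigma> \<Gamma>"
    if "\<Gamma> \<in> ctx" "\<Delta> \<in> ctx" "\<sigma> \<in> Field (fob T \<Delta>)" "k \<in> mono_maps \<Delta> (fob T \<Gamma>)" for \<Gamma> \<Delta> \<sigma> k
    using that op mono_maps_Field[OF that(4)]
    by (intro terms.Op) (auto simp: assoc_sig_def)
  have "order_ineqs ctx T \<subseteq> inequations ctx \<Sigma>"
    using op by (auto simp: order_ineqs_def inequations_def intro: FieldI1 FieldI2)
  moreover have "subst_eqs ctx T \<mu> \<subseteq> inequations ctx \<Sigma>"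
    using op sub kl_Field ctx_obj
    by (auto simp: subst_eqs_def inequations_def equation_def)
  moreover have "unit_eqs ctx \<eta> \<subseteq> inequations ctx \<Sigma>"
    using op mono_maps_Field[OF eta_map] ctx_obj
    by (auto simp: unit_eqs_def inequations_def equation_def intro: terms.Var)
  ultimately show ?thesis by (simp add: assoc_ineqs_def)
qed

lemma \<V>_simps [simp]:
  "hom \<V> A B = {h \<in> mono_maps (poset A) (poset B).
     \<forall>\<Gamma>\<in>ctx. \<forall>\<sigma>\<in>Field (fob T \<Gamma>). \<forall>f\<in>mono_maps \<Gamma> (poset A).
       h (oper A \<Gamma> \<sigma> f) = oper B \<Gamma> \<sigma> (compose (Field \<Gamma>) h f)}"
  "ide \<V> A = (\<lambda>x\<in>Field (poset A). x)"
  "cmp \<V> A B C g f = compose (Field (poset A)) g f"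
  by (simp_all add: variety_def Alg_def assoc_sig_def)

lemma \<V>_obj:
  "A \<in> obj \<V> \<longleftrightarrow> A \<in> obj (Alg ctx \<Sigma>) \<and> (\<forall>e\<in>assoc_ineqs ctx T \<eta> \<mu>. satisfies A e)"
  by (simp add: variety_def)

lemma \<V>_laws:
  assumes "A \<in> obj \<V>"
  shows \<V>_poset: "poset A \<in> obj Pos"
    and \<V>_Field: "\<Gamma> \<in> ctx \<Longrightarrow> \<sigma> \<in> Field (fob T \<Gamma>) \<Longrightarrow> f \<in> mono_maps \<Gamma> (poset A) \<Longrightarrow>
      oper A \<Gamma> \<sigma> f \<in> Field (poset A)"
    and \<V>_order: "\<Gamma> \<in> ctx \<Longrightarrow> f \<in> mono_maps \<Gamma> (poset A) \<Longrightarrow> (\<sigma>, \<tau>) \<in> fob T \<Gamma> \<Longrightarrow>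
      (oper A \<Gamma> \<sigma> f, oper A \<Gamma> \<tau> f) \<in> poset A"
    and \<V>_subst: "\<Gamma> \<in> ctx \<Longrightarrow> f \<in> mono_maps \<Gamma> (poset A) \<Longrightarrow> \<Delta> \<in> ctx \<Longrightarrow>
      k \<in> mono_maps \<Delta> (fob T \<Gamma>) \<Longrightarrow> \<sigma> \<in> Field (fob T \<Delta>) \<Longrightarrow>
      oper A \<Gamma> (kl \<Delta> \<Gamma> k \<sigma>) f = oper A \<Delta> \<sigma> (\<lambda>i\<in>Field \<Delta>. oper A \<Gamma> (k i) f)"
    and \<V>_unit: "\<Gamma> \<in> ctx \<Longrightarrow> f \<in> mono_maps \<Gamma> (poset A) \<Longrightarrow> x \<in> Field \<Gamma> \<Longrightarrow>
      oper A \<Gamma> (\<eta> \<Gamma> x) f = f x"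
proof -
  have A: "A \<in> obj (Alg ctx \<Sigma>)" and S: "\<forall>e\<in>assoc_ineqs ctx T \<eta> \<mu>. satisfies A e"
    using assms by (simp_all add: \<V>_obj)
  show "poset A \<in> obj Pos"
    "\<Gamma> \<in> ctx \<Longrightarrow> \<sigma> \<in> Field (fob T \<Gamma>) \<Longrightarrow> f \<in> mono_maps \<Gamma> (poset A) \<Longrightarrow>
      oper A \<Gamma> \<sigma> f \<in> Field (poset A)"
    using Alg_obj[OF A] by blast+
  note S' = S[unfolded satisfies_assoc_ineqs[OF A], rule_format]
  show "\<Gamma> \<in> ctx \<Longrightarrow> f \<in> mono_maps \<Gamma> (poset A) \<Longrightarrow> (\<sigma>, \<tau>) \<in> fob T \<Gamma> \<Longrightarrow>
      (oper A \<Gamma> \<sigma> f, oper A \<Gamma> \<tau> f) \<in> poset A"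
    "\<Gamma> \<in> ctx \<Longrightarrow> f \<in> mono_maps \<Gamma> (poset A) \<Longrightarrow> \<Delta> \<in> ctx \<Longrightarrow>
      k \<in> mono_maps \<Delta> (fob T \<Gamma>) \<Longrightarrow> \<sigma> \<in> Field (fob T \<Delta>) \<Longrightarrow>
      oper A \<Gamma> (kl \<Delta> \<Gamma> k \<sigma>) f = oper A \<Delta> \<sigma> (\<lambda>i\<in>Field \<Delta>. oper A \<Gamma> (k i) f)"
    "\<Gamma> \<in> ctx \<Longrightarrow> f \<in> mono_maps \<Gamma> (poset A) \<Longrightarrow> x \<in> Field \<Gamma> \<Longrightarrow>
      oper A \<Gamma> (\<eta> \<Gamma> x) f = f x"
    using S' by blast+
qed

text \<open>Naturality is the special case of the substitution law in which variables are substituted for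
  variables, because \<open>Tm = (\<eta> \<cdot> m)\<^sup>*\<close>.\<close>

lemma \<V>_nat:
  assumes A: "A \<in> obj \<V>" and G: "\<Gamma> \<in> ctx" "\<Delta> \<in> ctx" and m: "m \<in> mono_maps \<Delta> \<Gamma>"
    and s: "s \<in> Field (fob T \<Delta>)" and f: "f \<in> mono_maps \<Gamma> (poset A)"
  shows "oper A \<Gamma> (fmor T \<Delta> \<Gamma> m s) f = oper A \<Delta> s (compose (Field \<Delta>) f m)"
proof -
  have "(\<lambda>i\<in>Field \<Delta>. oper A \<Gamma> (compose (Field \<Delta>) (\<eta> \<Gamma>) m i) f) = compose (Field \<Delta>) f m"
    using \<V>_unit[OF A G(1) f] mono_maps_Field[OF m] by (auto simp: compose_def fun_eq_iff)
  then show ?thesis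
    using \<V>_subst[OF A G(1) f G(2) mono_maps_compose[OF m eta_map[OF ctx_obj[OF G(1)]]] s]
      T_eq_kl[OF ctx_obj[OF G(2)] ctx_obj[OF G(1)] m s] by simp
qed

lemma is_category_\<V>: "is_category \<V>"
proof -
  have comp: "compose (Field (poset A)) g f \<in> hom \<V> A C"
    if A: "A \<in> obj \<V>" and f: "f \<in> hom \<V> A B" and g: "g \<in> hom \<V> B C" for A B C f g
  proof -
    have fm: "f \<in> mono_maps (poset A) (poset B)" and gm: "g \<in> mono_maps (poset B) (poset C)"
      using f g by simp_all
    have "compose (Field (poset A)) g f (oper A \<Gamma> \<sigma> u) =
        oper C \<Gamma> \<sigma> (compose (Field \<Gamma>) (compose (Field (poset A)) g f) u)"
      if "\<Gamma> \<in> ctx" "\<sigma> \<in> Field (fob T \<Gamma>)" "u \<in> mono_maps \<Gamma> (poset A)" for \<Gamma> \<sigma> u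
      using that f g \<V>_Field[OF A that] mono_maps_compose[OF that(3) fm]
        compose_mono_maps_assoc[OF that(3), of g f] by (simp add: compose_eq)
    then show ?thesis using mono_maps_compose[OF fm gm] by simp
  qed
  have ide: "(\<lambda>x\<in>Field (poset A). x) \<in> hom \<V> A A" if A: "A \<in> obj \<V>" for A
    using mono_maps_ide[of "poset A" "poset A"] \<V>_Field[OF A]
    by (simp add: compose_mono_maps_id(2))
  have mono: "f \<in> hom \<V> A B \<Longrightarrow> f \<in> mono_maps (poset A) (poset B)" for A B f by simp
  show ?thesis
    unfolding is_category_def \<V>_simps(2,3)
    by (intro conjI ballI)
      (rule ide comp compose_mono_maps_assoc[OF mono] compose_mono_maps_id[OF mono], assumption+)+
qed

section \<open>Operations of arbitrary finite arity\<close>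

text \<open>Finite subposets of \<open>X\<close> are in general not contexts but only isomorphic to contexts. Once the
  operations of an algebra are extended to all finite posets as arities, these isomorphisms no
  longer appear.\<close>

lemma iso_to_context:
  fixes P :: "'u rel"
  assumes "P \<in> obj Pos" "finite (Field P)"
  obtains \<Gamma> i j where "\<Gamma> \<in> ctx" "i \<in> mono_maps P \<Gamma>" "j \<in> mono_maps \<Gamma> P"
    "\<And>x. x \<in> Field P \<Longrightarrow> j (i x) = x" "\<And>y. y \<in> Field \<Gamma> \<Longrightarrow> i (j y) = y"
proof -
  have "\<exists>\<Gamma>\<in>ctx. \<exists>f. isomorphism Pos P \<Gamma> f"
    using ctx assms unfolding is_context_set_def Pos_obj by blast
  then obtain \<Gamma> i j where "\<Gamma> \<in> ctx" "i \<in> mono_maps P \<Gamma>" "j \<in> mono_maps \<Gamma> P"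
    and e: "compose (Field P) j i = (\<lambda>x\<in>Field P. x)" "compose (Field \<Gamma>) i j = (\<lambda>x\<in>Field \<Gamma>. x)"
    unfolding isomorphism_def by auto
  moreover have "j (i x) = x" if "x \<in> Field P" for x
    using fun_cong[OF e(1), of x] that by (simp add: compose_eq)
  moreover have "i (j y) = y" if "y \<in> Field \<Gamma>" for y
    using fun_cong[OF e(2), of y] that by (simp add: compose_eq)
  ultimately show ?thesis using that by blast
qed

text \<open>A context isomorphic to \<open>P\<close>, with a pair of inverse isomorphisms. If \<open>P\<close> is itself a context,
  the isomorphism may be a non-trivial automorphism.\<close>

definition rep :: "'u rel \<Rightarrow> 'u rel \<times> ('u \<Rightarrow> 'u) \<times> ('u \<Rightarrow> 'u)" where
  "rep P = (SOME (\<Gamma>, i, j). \<Gamma> \<in> ctx \<and> i \<in> mono_maps P \<Gamma> \<and> j \<in> mono_maps \<Gamma> P \<and>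
     (\<forall>x\<in>Field P. j (i x) = x) \<and> (\<forall>y\<in>Field \<Gamma>. i (j y) = y))"

text \<open>The operation \<open>t \<in> TP\<close> in the algebra \<open>A\<close>, applied to the arguments \<open>f : P \<rightarrow> A\<close>.\<close>

definition xop :: "('u, 'u) algebra \<Rightarrow> 'u rel \<Rightarrow> 'u \<Rightarrow> ('u \<Rightarrow> 'u) \<Rightarrow> 'u" where
  "xop A P t f = (case rep P of (\<Gamma>, i, j) \<Rightarrow>
     oper A \<Gamma> (fmor T P \<Gamma> i t) (compose (Field \<Gamma>) f j))"

lemma xopE:
  assumes "P \<in> obj Pos" "finite (Field P)"
  obtains \<Gamma> i j where "\<Gamma> \<in> ctx" "i \<in> mono_maps P \<Gamma>" "j \<in> mono_maps \<Gamma> P"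
    "\<And>x. x \<in> Field P \<Longrightarrow> j (i x) = x" "\<And>y. y \<in> Field \<Gamma> \<Longrightarrow> i (j y) = y"
    "\<And>A t f. xop A P t f = oper A \<Gamma> (fmor T P \<Gamma> i t) (compose (Field \<Gamma>) f j)"
proof -
  define good where "good = (\<lambda>(\<Gamma>, i, j). \<Gamma> \<in> ctx \<and> i \<in> mono_maps P \<Gamma> \<and> j \<in> mono_maps \<Gamma> P \<and>
     (\<forall>x\<in>Field P. j (i x) = x) \<and> (\<forall>y\<in>Field \<Gamma>. i (j y) = y))"
  obtain \<Gamma>0 i0 j0 where "\<Gamma>0 \<in> ctx" "i0 \<in> mono_maps P \<Gamma>0" "j0 \<in> mono_maps \<Gamma>0 P"
    "\<And>x. x \<in> Field P \<Longrightarrow> j0 (i0 x) = x" "\<And>y. y \<in> Field \<Gamma>0 \<Longrightarrow> i0 (j0 y) = y"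
    using iso_to_context[OF assms] by blast
  then have "good (\<Gamma>0, i0, j0)" by (simp add: good_def)
  then have "good (rep P)" unfolding rep_def good_def by (rule someI)
  moreover obtain \<Gamma> i j where "rep P = (\<Gamma>, i, j)" by (cases "rep P")
  ultimately show ?thesis by (intro that[of \<Gamma> i j]) (auto simp: xop_def good_def)
qed

text \<open>The chosen isomorphism cancels by naturality, whichever it is.\<close>

lemma xop_context:
  assumes A: "A \<in> obj \<V>" and G: "\<Gamma> \<in> ctx" and s: "\<sigma> \<in> Field (fob T \<Gamma>)"
    and f: "f \<in> mono_maps \<Gamma> (poset A)"
  shows "xop A \<Gamma> \<sigma> f = oper A \<Gamma> \<sigma> f"
proof -
  obtain \<Gamma>' i j where r: "\<Gamma>' \<in> ctx" "i \<in> mono_maps \<Gamma> \<Gamma>'" "j \<in> mono_maps \<Gamma>' \<Gamma>"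
    "\<And>x. x \<in> Field \<Gamma> \<Longrightarrow> j (i x) = x"
    "xop A \<Gamma> \<sigma> f = oper A \<Gamma>' (fmor T \<Gamma> \<Gamma>' i \<sigma>) (compose (Field \<Gamma>') f j)"
    using xopE[OF ctxD[OF G]] by metis
  have "compose (Field \<Gamma>) (compose (Field \<Gamma>') f j) i = f"
    using r(4) mono_maps_Field[OF r(2)] extensional_arb[OF mono_maps_ext[OF f]]
    by (auto simp: compose_def restrict_def fun_eq_iff)
  then show ?thesis
    using \<V>_nat[OF A r(1) G r(2) s mono_maps_compose[OF r(3) f]] r(5) by simp
qed

lemma xop_order:
  assumes A: "A \<in> obj \<V>" and P: "P \<in> obj Pos" "finite (Field P)"
    and f: "f \<in> mono_maps P (poset A)" and st: "(s, t) \<in> fob T P"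
  shows "(xop A P s f, xop A P t f) \<in> poset A"
proof -
  obtain \<Gamma> i j where r: "\<Gamma> \<in> ctx" "i \<in> mono_maps P \<Gamma>" "j \<in> mono_maps \<Gamma> P"
    "\<And>t. xop A P t f = oper A \<Gamma> (fmor T P \<Gamma> i t) (compose (Field \<Gamma>) f j)"
    using xopE[OF P] by metis
  show ?thesis
    using \<V>_order[OF A r(1) mono_maps_compose[OF r(3) f]
        mono_maps_mono[OF T_map[OF P(1) ctx_obj[OF r(1)] r(2)] st]] r(4) by simp
qed

lemma xop_Field:
  assumes A: "A \<in> obj \<V>" and P: "P \<in> obj Pos" "finite (Field P)"
    and f: "f \<in> mono_maps P (poset A)" and t: "t \<in> Field (fob T P)"
  shows "xop A P t f \<in> Field (poset A)"
proof -
  have "(t, t) \<in> fob T P" using T_obj[OF P(1)] t by (auto simp: Pos_obj intro: po_refl)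
  from xop_order[OF A P f this] show ?thesis by (rule FieldI1)
qed

lemma xop_unit:
  assumes A: "A \<in> obj \<V>" and P: "P \<in> obj Pos" "finite (Field P)"
    and f: "f \<in> mono_maps P (poset A)" and x: "x \<in> Field P"
  shows "xop A P (\<eta> P x) f = f x"
proof -
  obtain \<Gamma> i j where r: "\<Gamma> \<in> ctx" "i \<in> mono_maps P \<Gamma>" "j \<in> mono_maps \<Gamma> P"
    "\<And>x. x \<in> Field P \<Longrightarrow> j (i x) = x"
    "\<And>t. xop A P t f = oper A \<Gamma> (fmor T P \<Gamma> i t) (compose (Field \<Gamma>) f j)"
    using xopE[OF P] by metis
  have "i x \<in> Field \<Gamma>" using mono_maps_Field[OF r(2) x] .
  then show ?thesis
    using eta_nat[OF P(1) ctx_obj[OF r(1)] r(2) x]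
      \<V>_unit[OF A r(1) mono_maps_compose[OF r(3) f], of "i x"] r(4)[OF x] r(5)
    by (simp add: compose_eq)
qed

text \<open>With \<open>i : P \<cong> \<Gamma>\<close>, \<open>j = i\<inverse>\<close> and \<open>i' : Q \<cong> \<Gamma>'\<close>, the substitution \<open>k : P \<rightarrow> TQ\<close> becomes the substitution
  \<open>Ti' \<cdot> k \<cdot> j : \<Gamma> \<rightarrow> T\<Gamma>'\<close> between contexts, to which the law of the variety applies.\<close>

lemma xop_subst:
  assumes A: "A \<in> obj \<V>" and P: "P \<in> obj Pos" "finite (Field P)"
    and Q: "Q \<in> obj Pos" "finite (Field Q)"
    and f: "f \<in> mono_maps Q (poset A)" and k: "k \<in> mono_maps P (fob T Q)"
    and s: "s \<in> Field (fob T P)"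
  shows "xop A Q (kl P Q k s) f = xop A P s (\<lambda>x\<in>Field P. xop A Q (k x) f)"
proof -
  obtain \<Gamma> i j where r: "\<Gamma> \<in> ctx" "i \<in> mono_maps P \<Gamma>" "j \<in> mono_maps \<Gamma> P"
    "\<And>x. x \<in> Field P \<Longrightarrow> j (i x) = x"
    "\<And>t f. xop A P t f = oper A \<Gamma> (fmor T P \<Gamma> i t) (compose (Field \<Gamma>) f j)"
    using xopE[OF P] by metis
  obtain \<Gamma>' i' j' where r': "\<Gamma>' \<in> ctx" "i' \<in> mono_maps Q \<Gamma>'" "j' \<in> mono_maps \<Gamma>' Q"
    "\<And>t. xop A Q t f = oper A \<Gamma>' (fmor T Q \<Gamma>' i' t) (compose (Field \<Gamma>') f j')"
    using xopE[OF Q] by metis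
  note G = ctx_obj[OF r(1)] and G' = ctx_obj[OF r'(1)]
  let ?s = "fmor T P \<Gamma> i s" and ?f = "compose (Field \<Gamma>') f j'"
  let ?k = "compose (Field P) (fmor T Q \<Gamma>' i') k"
  have s': "?s \<in> Field (fob T \<Gamma>)" by (rule mono_maps_Field[OF T_map[OF P(1) G r(2)] s])
  have k': "?k \<in> mono_maps P (fob T \<Gamma>')" by (rule mono_maps_compose[OF k T_map[OF Q(1) G' r'(2)]])
  have "compose (Field P) j i = (\<lambda>x\<in>Field P. x)"
    using r(4) by (auto simp: compose_def fun_eq_iff)
  then have s_eq: "fmor T \<Gamma> P j ?s = s"
    using T_comp[OF P(1) G P(1) r(2,3) s] T_id[OF P(1) s] by simp
  have "xop A Q (kl P Q k s) f = oper A \<Gamma>' (kl P \<Gamma>' ?k (fmor T \<Gamma> P j ?s)) ?f"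
    using T_kl[OF P(1) Q(1) G' k r'(2) s] by (simp add: r'(4) s_eq)
  also have "\<dots> = oper A \<Gamma>' (kl \<Gamma> \<Gamma>' (compose (Field \<Gamma>) ?k j) ?s) ?f"
    using kl_T[OF G P(1) G' r(3) k' s'] by simp
  also have "\<dots> = oper A \<Gamma> ?s (\<lambda>y\<in>Field \<Gamma>. oper A \<Gamma>' (compose (Field \<Gamma>) ?k j y) ?f)"
    by (rule \<V>_subst[OF A r'(1) mono_maps_compose[OF r'(3) f] r(1) mono_maps_compose[OF r(3) k'] s'])
  also have "(\<lambda>y\<in>Field \<Gamma>. oper A \<Gamma>' (compose (Field \<Gamma>) ?k j y) ?f) =
      compose (Field \<Gamma>) (\<lambda>x\<in>Field P. xop A Q (k x) f) j"
    using mono_maps_Field[OF r(3)] by (auto simp: compose_def fun_eq_iff r'(4))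
  finally show ?thesis by (simp add: r(5))
qed

lemma xop_nat:
  assumes A: "A \<in> obj \<V>" and P: "P \<in> obj Pos" "finite (Field P)"
    and Q: "Q \<in> obj Pos" "finite (Field Q)"
    and f: "f \<in> mono_maps Q (poset A)" and m: "m \<in> mono_maps P Q" and s: "s \<in> Field (fob T P)"
  shows "xop A Q (fmor T P Q m s) f = xop A P s (compose (Field P) f m)"
proof -
  have "(\<lambda>x\<in>Field P. xop A Q (compose (Field P) (\<eta> Q) m x) f) = compose (Field P) f m"
    using xop_unit[OF A Q f] mono_maps_Field[OF m] by (auto simp: compose_def fun_eq_iff)
  then show ?thesis
    using xop_subst[OF A P Q f mono_maps_compose[OF m eta_map[OF Q(1)]] s]
      T_eq_kl[OF P(1) Q(1) m s] by simp
qed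

lemma xop_hom:
  assumes A: "A \<in> obj \<V>" and h: "h \<in> hom \<V> A B" and P: "P \<in> obj Pos" "finite (Field P)"
    and f: "f \<in> mono_maps P (poset A)" and t: "t \<in> Field (fob T P)"
  shows "h (xop A P t f) = xop B P t (compose (Field P) h f)"
proof -
  obtain \<Gamma> i j where r: "\<Gamma> \<in> ctx" "i \<in> mono_maps P \<Gamma>" "j \<in> mono_maps \<Gamma> P"
    "\<And>A t f. xop A P t f = oper A \<Gamma> (fmor T P \<Gamma> i t) (compose (Field \<Gamma>) f j)"
    using xopE[OF P] by metis
  have "fmor T P \<Gamma> i t \<in> Field (fob T \<Gamma>)"
    by (rule mono_maps_Field[OF T_map[OF P(1) ctx_obj[OF r(1)] r(2)] t])
  then show ?thesis
    using h r(1) mono_maps_compose[OF r(3) f]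
    by (simp add: r(4) compose_mono_maps_assoc[OF r(3)])
qed

section \<open>Free algebras\<close>

definition free :: "'u rel \<Rightarrow> ('u, 'u) algebra" where
  "free X = \<lparr>poset = fob T X,
     oper = (\<lambda>\<Gamma>\<in>ctx. \<lambda>\<sigma>\<in>\<Sigma> \<Gamma>. \<lambda>f\<in>mono_maps \<Gamma> (fob T X). kl \<Gamma> X f \<sigma>)\<rparr>"

lemma poset_free [simp]: "poset (free X) = fob T X"
  by (simp add: free_def)

lemma oper_free [simp]:
  "\<Gamma> \<in> ctx \<Longrightarrow> \<sigma> \<in> Field (fob T \<Gamma>) \<Longrightarrow> f \<in> mono_maps \<Gamma> (fob T X) \<Longrightarrow>
    oper (free X) \<Gamma> \<sigma> f = kl \<Gamma> X f \<sigma>"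
  by (simp add: free_def assoc_sig_def)

lemma free_obj:
  assumes X: "X \<in> obj Pos" shows "free X \<in> obj \<V>"
proof -
  have "oper (free X) \<in> (\<Pi>\<^sub>E \<Gamma>\<in>ctx. \<Pi>\<^sub>E \<sigma>\<in>\<Sigma> \<Gamma>. mono_maps \<Gamma> (fob T X) \<rightarrow>\<^sub>E Field (fob T X))"
    unfolding free_def algebra.simps assoc_sig_def
    using kl_Field[OF ctx_obj X] by (intro restrict_PiE_iff[THEN iffD2] ballI) blast
  then have A: "free X \<in> obj (Alg ctx \<Sigma>)"
    using T_obj[OF X] by (simp add: Alg_def)
  moreover have "\<forall>e\<in>assoc_ineqs ctx T \<eta> \<mu>. satisfies (free X) e"
    unfolding satisfies_assoc_ineqs[OF A] poset_free
  proof (intro ballI conjI allI impI)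
    fix \<Gamma> f assume G: "\<Gamma> \<in> ctx" and f: "f \<in> mono_maps \<Gamma> (fob T X)"
    note G' = ctx_obj[OF G]
    show "(oper (free X) \<Gamma> \<sigma> f, oper (free X) \<Gamma> \<tau> f) \<in> fob T X" if "(\<sigma>, \<tau>) \<in> fob T \<Gamma>" for \<sigma> \<tau>
      using mono_maps_mono[OF kl_map[OF G' X f] that] that G f by (simp add: FieldI1 FieldI2)
    show "oper (free X) \<Gamma> (\<eta> \<Gamma> x) f = f x" if "x \<in> Field \<Gamma>" for x
      using kl_eta[OF G' X f that] mono_maps_Field[OF eta_map[OF G'] that] G f by simp
    fix \<Delta> k \<sigma> assume D: "\<Delta> \<in> ctx" and k: "k \<in> mono_maps \<Delta> (fob T \<Gamma>)"
      and \<sigma>: "\<sigma> \<in> Field (fob T \<Delta>)"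
    note D' = ctx_obj[OF D]
    have "(\<lambda>i\<in>Field \<Delta>. oper (free X) \<Gamma> (k i) f) = compose (Field \<Delta>) (kl \<Gamma> X f) k"
      using mono_maps_Field[OF k] G f by (auto simp: compose_def fun_eq_iff)
    then show "oper (free X) \<Gamma> (kl \<Delta> \<Gamma> k \<sigma>) f =
        oper (free X) \<Delta> \<sigma> (\<lambda>i\<in>Field \<Delta>. oper (free X) \<Gamma> (k i) f)"
      using kl_kl[OF D' G' X k f \<sigma>] kl_Field[OF D' G' k \<sigma>] G f D \<sigma>
        mono_maps_compose[OF k kl_map[OF G' X f]] by simp
  qed
  ultimately show ?thesis by (simp add: \<V>_obj)
qed

lemma xop_free:
  assumes X: "X \<in> obj Pos" and P: "P \<in> obj Pos" "finite (Field P)"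
    and f: "f \<in> mono_maps P (fob T X)" and t: "t \<in> Field (fob T P)"
  shows "xop (free X) P t f = kl P X f t"
proof -
  obtain \<Gamma> i j where r: "\<Gamma> \<in> ctx" "i \<in> mono_maps P \<Gamma>" "j \<in> mono_maps \<Gamma> P"
    "\<And>x. x \<in> Field P \<Longrightarrow> j (i x) = x"
    "\<And>A t f. xop A P t f = oper A \<Gamma> (fmor T P \<Gamma> i t) (compose (Field \<Gamma>) f j)"
    using xopE[OF P] by metis
  note G = ctx_obj[OF r(1)]
  have t': "fmor T P \<Gamma> i t \<in> Field (fob T \<Gamma>)"
    by (rule mono_maps_Field[OF T_map[OF P(1) G r(2)] t])
  have f': "compose (Field \<Gamma>) f j \<in> mono_maps \<Gamma> (fob T X)" by (rule mono_maps_compose[OF r(3) f])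
  have "compose (Field P) (compose (Field \<Gamma>) f j) i = f"
    using r(4) mono_maps_Field[OF r(2)] extensional_arb[OF mono_maps_ext[OF f]]
    by (auto simp: compose_def restrict_def fun_eq_iff)
  then show ?thesis
    using kl_T[OF P(1) G X r(2) f' t] r(1) t' f' by (simp add: r(5))
qed

text \<open>Every element of \<open>TX\<close> is the value of an operation at generators: if it comes from \<open>s \<in> TP\<close>,
  it is the result of applying the operation \<open>s\<close> of arity \<open>P\<close> to the elements of \<open>P\<close>.\<close>

lemma emb_eq_xop:
  assumes X: "X \<in> obj Pos" and P: "P \<in> finite_subposets X" and s: "s \<in> Field (fob T P)"
  shows "emb P X s = xop (free X) P s (restrict (\<eta> X) (Field P))"
proof -
  note D = finite_subposetsD[OF X P]
  have "compose (Field P) (\<eta> X) (\<lambda>x\<in>Field P. x) = restrict (\<eta> X) (Field P)"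
    by (auto simp: compose_def fun_eq_iff)
  then show ?thesis
    using T_eq_kl[OF D(1) X mono_maps_ide[OF D(2)] s] xop_free[OF X D(1,3) _ s]
      mono_maps_compose[OF mono_maps_ide[OF D(2)] eta_map[OF X]] by (simp add: emb_def)
qed

text \<open>Homomorphisms commute with operations of any finite arity, so their values at generators
  determine all other values.\<close>

lemma hom_free_eqI:
  assumes X: "X \<in> obj Pos"
    and g: "g \<in> hom \<V> (free X) A" and h: "h \<in> hom \<V> (free X) A"
    and eq: "\<And>x. x \<in> Field X \<Longrightarrow> g (\<eta> X x) = h (\<eta> X x)"
  shows "g = h"
proof (rule mono_maps_eqI)
  show "g \<in> mono_maps (fob T X) (poset A)" "h \<in> mono_maps (fob T X) (poset A)"
    using g h by simp_all
  fix t assume "t \<in> Field (fob T X)"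
  then obtain P s where P: "P \<in> finite_subposets X" and s: "s \<in> Field (fob T P)"
    and t: "emb P X s = t" using emb_jointly_surj[OF X] by blast
  note D = finite_subposetsD[OF X P]
  let ?e = "restrict (\<eta> X) (Field P)"
  have e: "?e \<in> mono_maps P (poset (free X))"
    using mono_maps_mono[OF eta_map[OF X]] mono_maps_Field[OF eta_map[OF X]] D(2,4)
    by (auto intro!: restrict_mono_maps)
  have "compose (Field P) g ?e = compose (Field P) h ?e"
    using eq D(4) by (auto simp: compose_def fun_eq_iff)
  then show "g t = h t"
    using xop_hom[OF free_obj[OF X] g D(1,3) e s] xop_hom[OF free_obj[OF X] h D(1,3) e s]
      emb_eq_xop[OF X P s] t by simp
qed

text \<open>An algebra in the variety turns a monotone map \<open>h\<close> on \<open>X\<close> into the compatible family of maps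
  \<open>s \<mapsto> s\<^bsub>A\<^esub>(h|P)\<close> on the posets \<open>TP\<close>, hence into a map on \<open>TX\<close>. It is a homomorphism because the
  arguments of an operation in \<open>TX\<close> come from one \<open>TP\<close>, where the substitution law applies.\<close>

lemma hom_free_exists:
  assumes X: "X \<in> obj Pos" and A: "A \<in> obj \<V>" and h: "h \<in> mono_maps X (poset A)"
  shows "\<exists>g\<in>hom \<V> (free X) A. \<forall>x\<in>Field X. g (\<eta> X x) = h x"
proof -
  let ?S = "finite_subposets X"
  define m where "m P = (\<lambda>s\<in>Field (fob T P). xop A P s (restrict h (Field P)))" for P
  have hP: "restrict h (Field P) \<in> mono_maps P (poset A)" if "P \<in> ?S" for P
    using mono_maps_mono[OF h] mono_maps_Field[OF h] finite_subposetsD[OF X that]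
    by (auto intro!: restrict_mono_maps)
  have "\<exists>!g. g \<in> mono_maps (fob T X) (poset A) \<and>
    (\<forall>P\<in>?S. \<forall>t\<in>Field (fob T P). g (emb P X t) = m P t)"
  proof (rule T_universal[OF X \<V>_poset[OF A]])
    fix P assume P: "P \<in> ?S"
    note D = finite_subposetsD[OF X P]
    show "m P \<in> mono_maps (fob T P) (poset A)"
      unfolding m_def
      using xop_order[OF A D(1,3) hP[OF P]] xop_Field[OF A D(1,3) hP[OF P]]
      by (rule restrict_mono_maps)
  next
    fix P Q t assume P: "P \<in> ?S" and Q: "Q \<in> ?S" and PQ: "P \<subseteq> Q" and t: "t \<in> Field (fob T P)"
    note D = finite_subposetsD[OF X P] and E = finite_subposetsD[OF X Q]
    have "compose (Field P) (restrict h (Field Q)) (\<lambda>x\<in>Field P. x) = restrict h (Field P)"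
      using mono_Field[OF PQ] by (auto simp: compose_def fun_eq_iff)
    then show "m Q (emb P Q t) = m P t"
      using xop_nat[OF A D(1,3) E(1,3) hP[OF Q] mono_maps_ide[OF PQ] t]
        emb_Field[OF D(1) E(1) PQ t] t by (simp add: m_def emb_def)
  qed
  then obtain g where g: "g \<in> mono_maps (fob T X) (poset A)"
    and gm: "\<And>P t. P \<in> ?S \<Longrightarrow> t \<in> Field (fob T P) \<Longrightarrow> g (emb P X t) = xop A P t (restrict h (Field P))"
    unfolding m_def by auto
  have "g (oper (free X) \<Gamma> \<sigma> f) = oper A \<Gamma> \<sigma> (compose (Field \<Gamma>) g f)"
    if G: "\<Gamma> \<in> ctx" and \<sigma>: "\<sigma> \<in> Field (fob T \<Gamma>)" and f: "f \<in> mono_maps \<Gamma> (fob T X)" for \<Gamma> \<sigma> f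
  proof -
    note G' = ctx_obj[OF G] ctx_finite[OF G]
    obtain P f' where P: "P \<in> ?S" and f': "f' \<in> mono_maps \<Gamma> (fob T P)"
      and ff': "\<And>i. i \<in> Field \<Gamma> \<Longrightarrow> emb P X (f' i) = f i"
      using finite_map_factors[OF X _ G'(2) f] G'(1) by (auto simp: Pos_obj)
    note D = finite_subposetsD[OF X P]
    note h' = hP[OF P]
    have f_eq: "compose (Field \<Gamma>) (emb P X) f' = f"
      using ff' extensional_arb[OF mono_maps_ext[OF f]]
      by (auto simp: compose_def restrict_def fun_eq_iff)
    have gf: "(\<lambda>i\<in>Field \<Gamma>. xop A P (f' i) (restrict h (Field P))) = compose (Field \<Gamma>) g f"
      using gm[OF P] mono_maps_Field[OF f'] by (auto simp: compose_def fun_eq_iff ff'[symmetric])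
    have "g (oper (free X) \<Gamma> \<sigma> f) = g (kl \<Gamma> X (compose (Field \<Gamma>) (emb P X) f') \<sigma>)"
      using G \<sigma> f f_eq by simp
    also have "\<dots> = g (emb P X (kl \<Gamma> P f' \<sigma>))"
      using T_kl[OF G'(1) D(1) X f' mono_maps_ide[OF D(2)] \<sigma>] by (simp add: emb_def)
    also have "\<dots> = xop A P (kl \<Gamma> P f' \<sigma>) (restrict h (Field P))"
      using gm[OF P kl_Field[OF G'(1) D(1) f' \<sigma>]] .
    also have "\<dots> = xop A \<Gamma> \<sigma> (compose (Field \<Gamma>) g f)"
      using xop_subst[OF A G' D(1,3) h' f' \<sigma>] gf by simp
    also have "\<dots> = oper A \<Gamma> \<sigma> (compose (Field \<Gamma>) g f)"
      by (rule xop_context[OF A G \<sigma> mono_maps_compose[OF f g]])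
    finally show ?thesis .
  qed
  moreover have "g (\<eta> X x) = h x" if x: "x \<in> Field X" for x
  proof -
    obtain P where P: "P \<in> ?S" "Field P = {x}"
      using finite_subposet_containing[OF X, of "{x}"] x by auto
    note D = finite_subposetsD[OF X P(1)]
    have "\<eta> P x \<in> Field (fob T P)" using mono_maps_Field[OF eta_map[OF D(1)]] P(2) by simp
    moreover have "emb P X (\<eta> P x) = \<eta> X x"
      using eta_nat[OF D(1) X mono_maps_ide[OF D(2)], of x] P(2) by (simp add: emb_def)
    ultimately have "g (\<eta> X x) = xop A P (\<eta> P x) (restrict h (Field P))" using gm[OF P(1)] by metis
    also have "\<dots> = h x" using xop_unit[OF A D(1,3) hP[OF P(1)], of x] P(2) by simp
    finally show ?thesis .
  qed
  ultimately show ?thesis using g by (intro bexI[of _ g]) auto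
qed

lemma T_hom:
  assumes "X \<in> obj Pos" "Y \<in> obj Pos" "f \<in> mono_maps X Y"
  shows "fmor T X Y f \<in> hom \<V> (free X) (free Y)"
  using T_map[OF assms] T_kl[OF ctx_obj assms(1,2) _ assms(3)]
  by (simp add: mono_maps_compose[OF _ T_map[OF assms]])

lemma mu_hom:
  assumes X: "X \<in> obj Pos"
  shows "\<mu> X \<in> hom \<V> (free (fob T X)) (free X)"
proof -
  note TX = T_obj[OF X]
  have i: "(\<lambda>x\<in>Field (fob T X). x) \<in> mono_maps (fob T X) (fob T X)" by (rule mono_maps_ide) simp
  have "\<mu> X (kl \<Gamma> (fob T X) f \<sigma>) = kl \<Gamma> X (compose (Field \<Gamma>) (\<mu> X) f) \<sigma>"
    if "\<Gamma> \<in> ctx" "\<sigma> \<in> Field (fob T \<Gamma>)" "f \<in> mono_maps \<Gamma> (fob T (fob T X))" for \<Gamma> \<sigma> f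
  proof -
    have "compose (Field \<Gamma>) (kl (fob T X) X (\<lambda>x\<in>Field (fob T X). x)) f =
        compose (Field \<Gamma>) (\<mu> X) f"
      using kl_id[OF X] mono_maps_Field[OF that(3)] by (auto simp: compose_def fun_eq_iff)
    then show ?thesis
      using kl_kl[OF ctx_obj[OF that(1)] TX X that(3) i that(2)]
        kl_id[OF X kl_Field[OF ctx_obj[OF that(1)] TX that(3,2)]] by simp
  qed
  then show ?thesis
    using mu_map[OF X] by (simp add: mono_maps_compose[OF _ mu_map[OF X]])
qed

text \<open>The structure map \<open>TA \<rightarrow> A\<close> of an algebra of the variety as an Eilenberg-Moore algebra; these
  maps form the counit of the adjunction.\<close>

definition lift :: "('u, 'u) algebra \<Rightarrow> 'u \<Rightarrow> 'u" where
  "lift A = (SOME g. g \<in> hom \<V> (free (poset A)) A \<and> (\<forall>x\<in>Field (poset A). g (\<eta> (poset A) x) = x))"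

lemma lift:
  assumes A: "A \<in> obj \<V>"
  shows lift_hom: "lift A \<in> hom \<V> (free (poset A)) A"
    and lift_eta: "\<And>x. x \<in> Field (poset A) \<Longrightarrow> lift A (\<eta> (poset A) x) = x"
proof -
  have "\<exists>g. g \<in> hom \<V> (free (poset A)) A \<and> (\<forall>x\<in>Field (poset A). g (\<eta> (poset A) x) = x)"
    using hom_free_exists[OF \<V>_poset[OF A] A mono_maps_ide[OF subset_refl]] by fastforce
  from someI_ex[OF this, folded lift_def]
  show "lift A \<in> hom \<V> (free (poset A)) A"
    "\<And>x. x \<in> Field (poset A) \<Longrightarrow> lift A (\<eta> (poset A) x) = x" by blast+
qed

lemma lift_free:
  assumes X: "X \<in> obj Pos" shows "lift (free X) = \<mu> X"
proof (rule hom_free_eqI[OF T_obj[OF X]])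
  show "lift (free X) \<in> hom \<V> (free (fob T X)) (free X)" using lift_hom[OF free_obj[OF X]] by simp
  show "\<mu> X \<in> hom \<V> (free (fob T X)) (free X)" by (rule mu_hom[OF X])
  show "lift (free X) (\<eta> (fob T X) t) = \<mu> X (\<eta> (fob T X) t)" if "t \<in> Field (fob T X)" for t
    using lift_eta[OF free_obj[OF X], of t] mu_eta[OF X that] that by simp
qed

definition free_ftr :: "('u rel, 'u \<Rightarrow> 'u, ('u, 'u) algebra, 'u \<Rightarrow> 'u) ftr" where
  "free_ftr = \<lparr>fob = free, fmor = fmor T\<rparr>"

lemma forget_free: "comp_ftr forget free_ftr = T"
  by (rule ftr.equality) (simp_all add: comp_ftr_def forget_def free_ftr_def)

lemma hom_\<V>_compose:
  "A \<in> obj \<V> \<Longrightarrow> B \<in> obj \<V> \<Longrightarrow> C \<in> obj \<V> \<Longrightarrow> f \<in> hom \<V> A B \<Longrightarrow> g \<in> hom \<V> B C \<Longrightarrow>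
    compose (Field (poset A)) g f \<in> hom \<V> A C"
  using is_category_\<V> unfolding is_category_def \<V>_simps(3) by blast

lemma hom_\<V>_mono_maps: "h \<in> hom \<V> A B \<Longrightarrow> h \<in> mono_maps (poset A) (poset B)"
  by simp

lemma adjunction: "is_adjunction Pos \<V> free_ftr forget \<eta> lift"
proof -
  have [simp]: "fob free_ftr X = free X" "fmor free_ftr X Y f = fmor T X Y f"
    "fob forget A = poset A" "fmor forget A B h = h" for X Y f A B h
    by (simp_all add: free_ftr_def forget_def)
  have "is_functor Pos \<V> free_ftr"
    using functor_T free_obj T_hom unfolding is_functor_def by (simp del: \<V>_simps(1))
  moreover have "is_functor \<V> Pos forget"
    using \<V>_poset hom_\<V>_mono_maps unfolding is_functor_def by (simp del: \<V>_simps(1))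
  moreover have "is_nat_trans Pos Pos id_ftr (comp_ftr forget free_ftr) \<eta>"
    using monad unfolding forget_free is_monad_def by blast
  moreover have "is_nat_trans \<V> \<V> (comp_ftr free_ftr forget) id_ftr lift"
    unfolding is_nat_trans_def
  proof (intro conjI ballI)
    show "lift A \<in> hom \<V> (fob (comp_ftr free_ftr forget) A) (fob id_ftr A)" if "A \<in> obj \<V>" for A
      using lift_hom[OF that] by (simp add: comp_ftr_def id_ftr_def del: \<V>_simps(1))
    fix A B h assume A: "A \<in> obj \<V>" and B: "B \<in> obj \<V>" and h: "h \<in> hom \<V> A B"
    note a = \<V>_poset[OF A] and b = \<V>_poset[OF B] and hm = hom_\<V>_mono_maps[OF h]
    let ?A = "poset A" and ?B = "poset B"
    have "compose (Field (fob T ?A)) (lift B) (fmor T ?A ?B h) =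
        compose (Field (fob T ?A)) h (lift A)" (is "?l = ?r")
    proof (rule hom_free_eqI[OF a])
      show "?l \<in> hom \<V> (free ?A) B"
        using hom_\<V>_compose[OF free_obj[OF a] free_obj[OF b] B T_hom[OF a b hm] lift_hom[OF B]] by simp
      show "?r \<in> hom \<V> (free ?A) B"
        using hom_\<V>_compose[OF free_obj[OF a] A B lift_hom[OF A] h] by simp
      show "?l (\<eta> ?A x) = ?r (\<eta> ?A x)" if "x \<in> Field ?A" for x
        using that mono_maps_Field[OF eta_map[OF a] that] eta_nat[OF a b hm that]
          lift_eta[OF A that] lift_eta[OF B mono_maps_Field[OF hm that]]
        by (simp add: compose_eq)
    qed
    then show "cmp \<V> (fob (comp_ftr free_ftr forget) A) (fob (comp_ftr free_ftr forget) B)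
        (fob id_ftr B) (lift B) (fmor (comp_ftr free_ftr forget) A B h) =
      cmp \<V> (fob (comp_ftr free_ftr forget) A) (fob id_ftr A) (fob id_ftr B)
        (fmor id_ftr A B h) (lift A)"
      by (simp add: comp_ftr_def id_ftr_def)
  qed
  moreover have "compose (Field (fob T X)) (\<mu> X) (fmor T X (fob T X) (\<eta> X)) =
      (\<lambda>t\<in>Field (fob T X). t)" if "X \<in> obj Pos" for X
    using mu_T_eta[OF that] by (auto simp: compose_def fun_eq_iff)
  moreover have "compose (Field (poset A)) (lift A) (\<eta> (poset A)) = (\<lambda>x\<in>Field (poset A). x)"
    if "A \<in> obj \<V>" for A
    using lift_eta[OF that] by (auto simp: compose_def fun_eq_iff)
  ultimately show ?thesis
    unfolding is_adjunction_def by (simp add: Let_def lift_free)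
qed

lemma adj_mult_free: "X \<in> obj Pos \<Longrightarrow> adj_mult free_ftr forget lift X = \<mu> X"
  by (simp add: adj_mult_def forget_def free_ftr_def lift_free)

end

section \<open>The monad of the associated variety\<close>

theorem theorem4p4:
  fixes Posf :: "'u rel set"
    and T :: "('u rel, 'u \<Rightarrow> 'u, 'u rel, 'u \<Rightarrow> 'u) ftr"
    and \<eta> \<mu> :: "'u rel \<Rightarrow> 'u \<Rightarrow> 'u"
  assumes "universe TYPE('u)"
    and "is_context_set Posf"
    and "is_monad Pos T \<eta> \<mu>"
    and "is_finitary T"
  shows "is_free_algebra_monad Posf (assoc_sig T) (assoc_ineqs Posf T \<eta> \<mu>) T \<eta> \<mu>"
proof -
  have "natLeq \<le>o |UNIV :: 'u set|"
    using assms(1) unfolding universe_def by (blast intro: ordLess_imp_ordLeq)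
  then have "infinite (UNIV :: 'u set)" using infinite_iff_natLeq_ordLeq by blast
  then interpret finitary_monad T Posf \<eta> \<mu>
    using assms by unfold_locales (auto simp: is_monad_def)
  show ?thesis
    unfolding is_free_algebra_monad_def
  proof (intro conjI allI impI)
    show "assoc_ineqs Posf T \<eta> \<mu> \<subseteq> inequations Posf \<Sigma>" by (rule assoc_ineqs_subset)
    show "\<exists>F \<eta>' \<epsilon>. is_adjunction Pos \<V> F forget \<eta>' \<epsilon>" using adjunction by blast
    fix F \<eta>' \<epsilon> assume F: "is_adjunction Pos \<V> F forget \<eta>' \<epsilon>"
    have "isomorphic_monads Pos (comp_ftr forget F) \<eta>' (adj_mult F forget \<epsilon>)
        T \<eta> (adj_mult free_ftr forget lift)"
      using left_adjoints_isomorphic_monads[OF is_category_Pos is_category_\<V> F adjunction]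
      by (simp add: forget_free)
    then show "isomorphic_monads Pos (comp_ftr forget F) \<eta>' (adj_mult F forget \<epsilon>) T \<eta> \<mu>"
      unfolding isomorphic_monads_def by (simp add: adj_mult_free)
  qed
qed

end
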